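(* Let $G$ be a group, considered as a coarse space with its (right) finitary coarse structure. Then the following statements are equivalent: (i) $G$ admits a finitary selector; (ii) $G$ admits a 2-selector; (iii) $G$ is a finite extension of an infinite cyclic subgroup (i.e. $G$ contains an infinite cyclic subgroup of finite index), or $G$ is countable and locally finite (i.e. every finite subset of $G$ generates a finite subgroup).
   Context: A coarse structure on a set $X$ is a family $\mathcal{E}$ of subsets of $X\times X$ (called entourages) such that: each $E\in\mathcal{E}$ contains the diagonal $\triangle_X=\{(x,x):x\in X\}$; if $E,E'\in\mathcal{E}$ then $E\circ E'=\{(x,y):\exists z\ ((x,z)\in E,\ (z,y)\in E')\}\in\mathcal{E}$ and $E^{-1}=\{(y,x):(x,y)\in E\}\in\mathcal{E}$; and if $E\in\mathcal{E}$ and $\triangle_X\subseteq E'\subseteq E$ then $E'\in\mathcal{E}$. The pair $(X,\mathcal{E})$ is a coarse space. For $x\in X$, $Y\subseteq X$, $E\in\mathcal{E}$ put $E[x]=\{y\in X:(x,y)\in E\}$ and $E[Y]=\bigcup_{y\in Y}E[y]$. A subfamily $\mathcal{E}'\subseteq\mathcal{E}$ is a base of $\mathcal{E}$ if each $E\in\mathcal{E}$ is contained in some $E'\in\mathcal{E}'$. A subset $Y\subseteq X$ inherits the subspace coarse structure $\{E\cap(Y\times Y):E\in\mathcal{E}\}$. A map $f:X\to X'$ between coarse spaces $(X,\mathcal{E})$, $(X',\mathcal{E}')$ is macro-uniform if for every $E\in\mathcal{E}$ there is $E'\in\mathcal{E}'$ such that $f(E[x])\subseteq E'[f(x)]$ for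 each $x\in X$. Hyperballean: $\exp X$ is the set of all non-empty subsets of $X$, endowed with the coarse structure $\exp\mathcal{E}$ with base $\{\exp E:E\in\mathcal{E}\}$, where $(A,B)\in\exp E$ iff $A\subseteq E[B]$ and $B\subseteq E[A]$. For a non-empty subspace $\mathcal{F}$ of $\exp X$ (with the subspace coarse structure), an $\mathcal{F}$-selector of $(X,\mathcal{E})$ is a macro-uniform map $f:\mathcal{F}\to X$ with $f(A)\in A$ for each $A\in\mathcal{F}$. A 2-selector is an $\mathcal{F}$-selector for $\mathcal{F}=[X]^2$, the set of all two-element subsets of $X$. The (right) finitary coarse structure of a group $G$ with identity $e$ is the coarse structure with base $\{\{(x,y):x\in Fy\}: F\subseteq G \text{ finite},\ e\in F\}$. A finitary selector of $G$ is an $\mathcal{F}$-selector where $\mathcal{F}$ is the set $\mathcal{F}_G$ of all non-empty finite subsets of $G$ (these are exactly the non-empty bounded subsets of $G$, a set being bounded if it lies in $E[x]$ for some entourage $E$ and some $x\in G$). "Countable" includes finite. *)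

theory Defs
  imports "HOL-Algebra.Elementary_Groups" "HOL-Library.Countable_Set"
begin

(* For F a set of group elements, F #> y is the right translate Fy; for an entourage E,
   E `` {x} is E[x] and E `` Y is E[Y]. *)

definition coarse_structure :: "'a set \<Rightarrow> ('a \<times> 'a) set set \<Rightarrow> bool" where
  "coarse_structure X \<E> \<longleftrightarrow>
     \<E> \<noteq> {} \<and>
     (\<forall>E\<in>\<E>. E \<subseteq> X \<times> X \<and> Id_on X \<subseteq> E) \<and>
     (\<forall>E\<in>\<E>. \<forall>E'\<in>\<E>. E O E' \<in> \<E>) \<and>
     (\<forall>E\<in>\<E>. E\<inverse> \<in> \<E>) \<and>
     (\<forall>E\<in>\<E>. \<forall>E'. Id_on X \<subseteq> E' \<and> E' \<subseteq> E \<longrightarrow> E' \<in> \<E>)"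

lemma coarse_structureD:
  assumes "coarse_structure X \<E>"
  shows "\<E> \<noteq> {}"
    and "\<forall>E\<in>\<E>. E \<subseteq> X \<times> X \<and> Id_on X \<subseteq> E"
    and "\<forall>E\<in>\<E>. \<forall>E'\<in>\<E>. E O E' \<in> \<E>"
    and "\<forall>E\<in>\<E>. E\<inverse> \<in> \<E>"
    and "\<forall>E\<in>\<E>. \<forall>E'. Id_on X \<subseteq> E' \<and> E' \<subseteq> E \<longrightarrow> E' \<in> \<E>"
proof -
  note 1 = assms[unfolded coarse_structure_def]
  show "\<E> \<noteq> {}" by (rule 1[THEN conjunct1])
  note 2 = 1[THEN conjunct2]
  show "\<forall>E\<in>\<E>. E \<subseteq> X \<times> X \<and> Id_on X \<subseteq> E" by (rule 2[THEN conjunct1])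
  note 3 = 2[THEN conjunct2]
  show "\<forall>E\<in>\<E>. \<forall>E'\<in>\<E>. E O E' \<in> \<E>" by (rule 3[THEN conjunct1])
  note 4 = 3[THEN conjunct2]
  show "\<forall>E\<in>\<E>. E\<inverse> \<in> \<E>" by (rule 4[THEN conjunct1])
  show "\<forall>E\<in>\<E>. \<forall>E'. Id_on X \<subseteq> E' \<and> E' \<subseteq> E \<longrightarrow> E' \<in> \<E>"
    by (rule 4[THEN conjunct2])
qed

definition coarse_base :: "('a \<times> 'a) set set \<Rightarrow> ('a \<times> 'a) set set \<Rightarrow> bool" where
  "coarse_base \<B> \<E> \<longleftrightarrow> \<B> \<subseteq> \<E> \<and> (\<forall>E\<in>\<E>. \<exists>E'\<in>\<B>. E \<subseteq> E')"

definition coarse_of_base :: "'a set \<Rightarrow> ('a \<times> 'a) set set \<Rightarrow> ('a \<times> 'a) set set" where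
  "coarse_of_base X \<B> = {E. Id_on X \<subseteq> E \<and> (\<exists>E'\<in>\<B>. E \<subseteq> E')}"

lemma coarse_of_base_unique:
  assumes "coarse_structure X \<E>" and "coarse_base \<B> \<E>"
  shows "\<E> = coarse_of_base X \<B>"
proof (intro equalityI subsetI)
  fix E assume "E \<in> \<E>"
  then have "Id_on X \<subseteq> E" "\<exists>E'\<in>\<B>. E \<subseteq> E'"
    using coarse_structureD(2)[OF assms(1)] assms(2) by (simp_all add: coarse_base_def)
  then show "E \<in> coarse_of_base X \<B>" by (simp add: coarse_of_base_def)
next
  fix E assume "E \<in> coarse_of_base X \<B>"
  then obtain E' where E: "Id_on X \<subseteq> E" "E \<subseteq> E'" "E' \<in> \<B>"
    unfolding coarse_of_base_def by blast
  then have "E' \<in> \<E>" using assms(2) by (auto simp: coarse_base_def)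
  then show "E \<in> \<E>" using E coarse_structureD(5)[OF assms(1)] by blast
qed

lemma coarse_base_coarse_of_base:
  assumes "\<And>B. B \<in> \<B> \<Longrightarrow> Id_on X \<subseteq> B"
  shows "coarse_base \<B> (coarse_of_base X \<B>)"
  using assms unfolding coarse_base_def coarse_of_base_def by blast

lemma coarse_structure_coarse_of_base:
  assumes ne: "\<B> \<noteq> {}"
    and sub: "\<And>B. B \<in> \<B> \<Longrightarrow> Id_on X \<subseteq> B \<and> B \<subseteq> X \<times> X"
    and comp: "\<And>B C. B \<in> \<B> \<Longrightarrow> C \<in> \<B> \<Longrightarrow> \<exists>D\<in>\<B>. B O C \<subseteq> D"
    and conv: "\<And>B. B \<in> \<B> \<Longrightarrow> \<exists>D\<in>\<B>. B\<inverse> \<subseteq> D"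
  shows "coarse_structure X (coarse_of_base X \<B>)"
  unfolding coarse_structure_def
proof (intro conjI ballI allI impI)
  show "coarse_of_base X \<B> \<noteq> {}"
    using ne sub unfolding coarse_of_base_def by blast
next
  fix E assume "E \<in> coarse_of_base X \<B>"
  then show "E \<subseteq> X \<times> X" "Id_on X \<subseteq> E"
    using sub unfolding coarse_of_base_def by blast+
next
  fix E E' assume E: "E \<in> coarse_of_base X \<B>" and E': "E' \<in> coarse_of_base X \<B>"
  then obtain B C where BC: "B \<in> \<B>" "C \<in> \<B>" "E \<subseteq> B" "E' \<subseteq> C"
    unfolding coarse_of_base_def by blast
  obtain D where "D \<in> \<B>" "B O C \<subseteq> D" using comp BC by blast
  then have "\<exists>D\<in>\<B>. E O E' \<subseteq> D" using BC by blast
  moreover have "Id_on X \<subseteq> E O E'" using E E' unfolding coarse_of_base_def by blast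
  ultimately show "E O E' \<in> coarse_of_base X \<B>" unfolding coarse_of_base_def by blast
next
  fix E assume E: "E \<in> coarse_of_base X \<B>"
  then obtain B where B: "B \<in> \<B>" "E \<subseteq> B" unfolding coarse_of_base_def by blast
  obtain D where "D \<in> \<B>" "B\<inverse> \<subseteq> D" using conv B by blast
  then have "\<exists>D\<in>\<B>. E\<inverse> \<subseteq> D" using B by blast
  moreover have "Id_on X \<subseteq> E\<inverse>" using E unfolding coarse_of_base_def by blast
  ultimately show "E\<inverse> \<in> coarse_of_base X \<B>" unfolding coarse_of_base_def by blast
next
  fix E E' assume "E \<in> coarse_of_base X \<B>" "Id_on X \<subseteq> E' \<and> E' \<subseteq> E"
  then show "E' \<in> coarse_of_base X \<B>" unfolding coarse_of_base_def by blast
qed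

definition coarse_subspace :: "'a set \<Rightarrow> ('a \<times> 'a) set set \<Rightarrow> ('a \<times> 'a) set set" where
  "coarse_subspace Y \<E> = {E \<inter> (Y \<times> Y) | E. E \<in> \<E>}"

(* A map between carriers is a total HOL function; only its values on X matter. *)
definition macro_uniform ::
  "'a set \<Rightarrow> ('a \<times> 'a) set set \<Rightarrow> 'b set \<Rightarrow> ('b \<times> 'b) set set \<Rightarrow> ('a \<Rightarrow> 'b) \<Rightarrow> bool" where
  "macro_uniform X \<E> X' \<E>' f \<longleftrightarrow>
     f \<in> X \<rightarrow> X' \<and>
     (\<forall>E\<in>\<E>. \<exists>E'\<in>\<E>'. \<forall>x\<in>X. f ` (E `` {x}) \<subseteq> E' `` {f x})"

definition nonempty_subsets :: "'a set \<Rightarrow> 'a set set" where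
  "nonempty_subsets X = {A. A \<subseteq> X \<and> A \<noteq> {}}"

definition exp_entourage :: "'a set \<Rightarrow> ('a \<times> 'a) set \<Rightarrow> ('a set \<times> 'a set) set" where
  "exp_entourage X E =
     {(A, B). A \<in> nonempty_subsets X \<and> B \<in> nonempty_subsets X \<and> A \<subseteq> E `` B \<and> B \<subseteq> E `` A}"

definition hyperballean :: "'a set \<Rightarrow> ('a \<times> 'a) set set \<Rightarrow> ('a set \<times> 'a set) set set" where
  "hyperballean X \<E> = coarse_of_base (nonempty_subsets X) (exp_entourage X ` \<E>)"

lemma exp_entourage_refl:
  assumes "coarse_structure X \<E>" and "E \<in> \<E>"
  shows "Id_on (nonempty_subsets X) \<subseteq> exp_entourage X E"
proof -
  have "Id_on X \<subseteq> E" using coarse_structureD(2)[OF assms(1)] assms(2) by simp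
  then have "A \<subseteq> E `` A" if "A \<subseteq> X" for A using that by blast
  then show ?thesis by (auto simp: exp_entourage_def nonempty_subsets_def)
qed

lemma coarse_base_hyperballean:
  assumes "coarse_structure X \<E>"
  shows "coarse_base (exp_entourage X ` \<E>) (hyperballean X \<E>)"
  unfolding hyperballean_def
  using exp_entourage_refl[OF assms] by (intro coarse_base_coarse_of_base) blast

lemma coarse_structure_hyperballean:
  assumes "coarse_structure X \<E>"
  shows "coarse_structure (nonempty_subsets X) (hyperballean X \<E>)"
  unfolding hyperballean_def
proof (rule coarse_structure_coarse_of_base)
  show "exp_entourage X ` \<E> \<noteq> {}"
    using coarse_structureD(1)[OF assms] by simp
next
  fix B assume "B \<in> exp_entourage X ` \<E>"
  then show "Id_on (nonempty_subsets X) \<subseteq> B \<and> B \<subseteq> nonempty_subsets X \<times> nonempty_subsets X"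
    using exp_entourage_refl[OF assms] by (auto simp: exp_entourage_def)
next
  fix B C assume "B \<in> exp_entourage X ` \<E>" "C \<in> exp_entourage X ` \<E>"
  then obtain E E' where EE: "E \<in> \<E>" "E' \<in> \<E>" "B = exp_entourage X E" "C = exp_entourage X E'"
    by blast
  let ?D = "(E O E') O (E' O E)"
  have EO: "E O E' \<in> \<E>" "E' O E \<in> \<E>"
    using coarse_structureD(3)[OF assms] EE by simp_all
  then have D: "?D \<in> \<E>"
    using coarse_structureD(3)[OF assms] by blast
  have id: "Id_on X \<subseteq> E O E'" "Id_on X \<subseteq> E' O E"
    using coarse_structureD(2)[OF assms] EO by simp_all
  have X: "E O E' \<subseteq> X \<times> X" "E' O E \<subseteq> X \<times> X"
    using coarse_structureD(2)[OF assms] EO by simp_all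
  have sub: "E O E' \<subseteq> ?D" "E' O E \<subseteq> ?D"
  proof -
    show "E O E' \<subseteq> ?D"
    proof
      fix p assume p: "p \<in> E O E'"
      obtain a b where ab: "p = (a, b)" by (cases p)
      have "(b, b) \<in> E' O E" using id X p ab by blast
      then show "p \<in> ?D" using p ab by blast
    qed
    show "E' O E \<subseteq> ?D"
    proof
      fix p assume p: "p \<in> E' O E"
      obtain a b where ab: "p = (a, b)" by (cases p)
      have "(a, a) \<in> E O E'" using id X p ab by blast
      then show "p \<in> ?D" using p ab by blast
    qed
  qed
  have "B O C \<subseteq> exp_entourage X ?D"
  proof
    fix p assume "p \<in> B O C"
    then obtain P Q R where p: "p = (P, R)" "(P, Q) \<in> B" "(Q, R) \<in> C" by blast
    have "P \<subseteq> (E' O E) `` R" "R \<subseteq> (E O E') `` P"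
      using p EE unfolding exp_entourage_def by blast+
    then have "P \<subseteq> ?D `` R" "R \<subseteq> ?D `` P"
      using Image_mono[OF sub(2) order_refl] Image_mono[OF sub(1) order_refl] by (meson order_trans)+
    then show "p \<in> exp_entourage X ?D"
      using p EE by (simp add: exp_entourage_def)
  qed
  then show "\<exists>D\<in>exp_entourage X ` \<E>. B O C \<subseteq> D" using D by blast
next
  fix B assume B: "B \<in> exp_entourage X ` \<E>"
  then have "B\<inverse> \<subseteq> B" unfolding exp_entourage_def by blast
  then show "\<exists>D\<in>exp_entourage X ` \<E>. B\<inverse> \<subseteq> D" using B by blast
qed

(* \<F> is not required to be non-empty: if X has at most one point, then there are no two-element
   subsets and every function is vacuously a 2-selector of X. *)
definition selector ::
  "'a set \<Rightarrow> ('a \<times> 'a) set set \<Rightarrow> 'a set set \<Rightarrow> ('a set \<Rightarrow> 'a) \<Rightarrow> bool" where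
  "selector X \<E> \<F> f \<longleftrightarrow>
     macro_uniform \<F> (coarse_subspace \<F> (hyperballean X \<E>)) X \<E> f \<and> (\<forall>A\<in>\<F>. f A \<in> A)"

definition two_subsets :: "'a set \<Rightarrow> 'a set set" where
  "two_subsets X = {A. A \<subseteq> X \<and> card A = 2}"

definition finitary_entourage ::
  "('a, 'm) monoid_scheme \<Rightarrow> 'a set \<Rightarrow> ('a \<times> 'a) set" where
  "finitary_entourage G F =
     {(x, y). x \<in> carrier G \<and> y \<in> carrier G \<and> x \<in> F #>\<^bsub>G\<^esub> y}"

definition finitary_base :: "('a, 'm) monoid_scheme \<Rightarrow> ('a \<times> 'a) set set" where
  "finitary_base G =
     {finitary_entourage G F | F. F \<subseteq> carrier G \<and> finite F \<and> \<one>\<^bsub>G\<^esub> \<in> F}"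

definition finitary_coarse :: "('a, 'm) monoid_scheme \<Rightarrow> ('a \<times> 'a) set set" where
  "finitary_coarse G = coarse_of_base (carrier G) (finitary_base G)"

lemma (in group) finitary_entourage_refl:
  assumes "\<one> \<in> F"
  shows "Id_on (carrier G) \<subseteq> finitary_entourage G F"
  using assms by (force simp: finitary_entourage_def r_coset_def)

lemma (in group) coarse_base_finitary:
  "coarse_base (finitary_base G) (finitary_coarse G)"
  unfolding finitary_coarse_def
proof (rule coarse_base_coarse_of_base)
  fix B assume "B \<in> finitary_base G"
  then show "Id_on (carrier G) \<subseteq> B"
    using finitary_entourage_refl unfolding finitary_base_def by blast
qed

lemma (in group) coarse_structure_finitary:
  "coarse_structure (carrier G) (finitary_coarse G)"
  unfolding finitary_coarse_def
proof (rule coarse_structure_coarse_of_base)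
  have "finitary_entourage G {\<one>} \<in> finitary_base G"
    unfolding finitary_base_def by blast
  then show "finitary_base G \<noteq> {}" by blast
next
  fix B assume "B \<in> finitary_base G"
  then show "Id_on (carrier G) \<subseteq> B \<and> B \<subseteq> carrier G \<times> carrier G"
    using finitary_entourage_refl unfolding finitary_base_def finitary_entourage_def by blast
next
  fix B C assume "B \<in> finitary_base G" "C \<in> finitary_base G"
  then obtain F H where
      F: "F \<subseteq> carrier G" "finite F" "\<one> \<in> F" "B = finitary_entourage G F"
    and H: "H \<subseteq> carrier G" "finite H" "\<one> \<in> H" "C = finitary_entourage G H"
    unfolding finitary_base_def by blast
  let ?K = "(\<lambda>(f, h). f \<otimes> h) ` (F \<times> H)"
  have K: "?K \<subseteq> carrier G" "finite ?K" using F H by auto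
  have "\<one> = (\<lambda>(f, h). f \<otimes> h) (\<one>, \<one>)" by simp
  then have one: "\<one> \<in> ?K" using F H by blast
  have "B O C \<subseteq> finitary_entourage G ?K"
  proof
    fix p assume "p \<in> B O C"
    then obtain x y z where p: "p = (x, z)" "(x, y) \<in> B" "(y, z) \<in> C" by blast
    have xyz: "x \<in> carrier G" "z \<in> carrier G"
      using p F H by (auto simp: finitary_entourage_def)
    obtain f where f: "f \<in> F" "x = f \<otimes> y"
      using p F by (auto simp: finitary_entourage_def r_coset_def)
    obtain h where h: "h \<in> H" "y = h \<otimes> z"
      using p H by (auto simp: finitary_entourage_def r_coset_def)
    have "x = (f \<otimes> h) \<otimes> z" using f h F H xyz m_assoc[of f h z] by (metis subsetD)
    moreover have "f \<otimes> h \<in> ?K" using f h by force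
    ultimately show "p \<in> finitary_entourage G ?K"
      using p xyz unfolding finitary_entourage_def r_coset_def by blast
  qed
  then show "\<exists>D\<in>finitary_base G. B O C \<subseteq> D"
    using K one unfolding finitary_base_def by blast
next
  fix B assume "B \<in> finitary_base G"
  then obtain F where
      F: "F \<subseteq> carrier G" "finite F" "\<one> \<in> F" "B = finitary_entourage G F"
    unfolding finitary_base_def by blast
  let ?K = "m_inv G ` F"
  have K: "?K \<subseteq> carrier G" "finite ?K" using F by auto
  have one: "\<one> \<in> ?K" using F inv_one by (metis imageI)
  have "B\<inverse> \<subseteq> finitary_entourage G ?K"
  proof
    fix p assume "p \<in> B\<inverse>"
    then obtain x y where p: "p = (y, x)" "(x, y) \<in> B" by blast
    have xy: "x \<in> carrier G" "y \<in> carrier G"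
      using p F by (auto simp: finitary_entourage_def)
    obtain f where f: "f \<in> F" "x = f \<otimes> y"
      using p F by (auto simp: finitary_entourage_def r_coset_def)
    have "y = inv f \<otimes> x" using f F xy inv_solve_left[of y f x] by auto
    then show "p \<in> finitary_entourage G ?K"
      using p xy f unfolding finitary_entourage_def r_coset_def by blast
  qed
  then show "\<exists>D\<in>finitary_base G. B\<inverse> \<subseteq> D"
    using K one unfolding finitary_base_def by blast
qed

definition admits_finitary_selector :: "('a, 'm) monoid_scheme \<Rightarrow> bool" where
  "admits_finitary_selector G \<longleftrightarrow>
     (\<exists>f. selector (carrier G) (finitary_coarse G) {A. A \<subseteq> carrier G \<and> finite A \<and> A \<noteq> {}} f)"

definition admits_2_selector :: "('a, 'm) monoid_scheme \<Rightarrow> bool" where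
  "admits_2_selector G \<longleftrightarrow>
     (\<exists>f. selector (carrier G) (finitary_coarse G) (two_subsets (carrier G)) f)"

definition finite_extension_of_infinite_cyclic :: "('a, 'm) monoid_scheme \<Rightarrow> bool" where
  "finite_extension_of_infinite_cyclic G \<longleftrightarrow>
     (\<exists>H. subgroup H G \<and> infinite H \<and> cyclic_group (G\<lparr>carrier := H\<rparr>) \<and> finite (rcosets\<^bsub>G\<^esub> H))"

definition locally_finite_group :: "('a, 'm) monoid_scheme \<Rightarrow> bool" where
  "locally_finite_group G \<longleftrightarrow>
     (\<forall>S. S \<subseteq> carrier G \<and> finite S \<longrightarrow> finite (generate G S))"

end

theory Submission
  imports Defs "HOL-Algebra.Multiplicative_Group"
begin

text \<open>
  A 2-selector orients every pair of distinct elements, and the orientation does not change when one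
  of the two points makes a step (a left multiplication) while the points stay far apart. So no two
  points can be exchanged by steps keeping them far apart.

  If \<open>S\<close> generates an infinite subgroup, exchanging two points by way of cosets shows that \<open>S\<close> together
  with finitely many elements for each element of \<open>S\<close> generates \<open>G\<close>. Hence \<open>G\<close> is countable, and
  finitely generated unless it is locally finite. An infinite finitely generated \<open>G\<close> cannot
  have one end, nor three ends, as points could be exchanged there. With two ends, some right
  translation \<open>w\<close> properly shrinks an end \<open>D\<close> by finitely many elements, and \<open>w\<close> generates
  an infinite cyclic subgroup of finite index.

  Conversely, the virtually cyclic groups have a coarse projection to the integers, and the countable
  locally finite groups a linear order with convex cosets for a chain of finite subgroups; in both
  cases taking minima is a finitary selector.
\<close>


subsection \<open>Selectors in terms of translates\<close>

text \<open>Steps multiply on the left and right translations commute with them, so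
  \<open>x \<otimes> inv y\<close> serves as a distance between \<open>x\<close> and
  \<open>y\<close>, and right translations are automorphisms of the Cayley graph. The obstacle is
  that a selector gives only a threshold for each single step: a long path may use infinitely many
  different steps, or bring the points together on the way. For arbitrary sets of steps the safe
  condition is therefore to lie in different cosets of a subgroup containing all thresholds. For a
  finite generating set there is one finite threshold, and paths can be kept away from a ball of
  that size; this is where the ends of the Cayley graph enter. They are represented by infinite
  almost invariant sets: at least \<open>n\<close> ends means \<open>n\<close> pairwise disjoint
  sets of this kind.\<close>

context group
begin

lemma m_inv_cancel [simp]:
  assumes "x \<in> carrier G" "y \<in> carrier G"
  shows "x \<otimes> (inv x \<otimes> y) = y" "inv x \<otimes> (x \<otimes> y) = y"
  using assms by (simp_all flip: m_assoc)

lemma m_inv_eq_iff [simp]: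
  "\<lbrakk>x \<in> carrier G; y \<in> carrier G\<rbrakk> \<Longrightarrow> inv x = inv y \<longleftrightarrow> x = y"
  by (metis inv_inv)

lemma mem_r_coset_iff:
  assumes "F \<subseteq> carrier G" "x \<in> carrier G" "y \<in> carrier G"
  shows "x \<in> F #> y \<longleftrightarrow> x \<otimes> inv y \<in> F"
proof
  assume "x \<in> F #> y"
  then show "x \<otimes> inv y \<in> F" using assms by (auto simp: r_coset_def m_assoc subset_iff)
next
  assume "x \<otimes> inv y \<in> F"
  moreover have "x = (x \<otimes> inv y) \<otimes> y" using assms by (simp add: m_assoc)
  ultimately show "x \<in> F #> y" unfolding r_coset_def by blast
qed

text \<open>A pair is in the entourage when its first point is in \<open>F\<close> times the second,
  so balls are translates of the inverses of \<open>F\<close>. This is why inverses appear whenever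
  entourages are converted to translates.\<close>

lemma finitary_entourage_Image:
  assumes "F \<subseteq> carrier G" "B \<subseteq> carrier G"
  shows "finitary_entourage G F `` B = (m_inv G ` F) <#> B"
proof (intro equalityI subsetI)
  fix y assume "y \<in> finitary_entourage G F `` B"
  then obtain x where x: "x \<in> B" "x \<in> carrier G" "y \<in> carrier G" "x \<in> F #> y"
    by (auto simp: finitary_entourage_def)
  then obtain u where u: "u \<in> F" "x = u \<otimes> y" by (auto simp: r_coset_def)
  then have "y = inv u \<otimes> x" using assms x by (simp add: subset_iff)
  then show "y \<in> (m_inv G ` F) <#> B" using u x unfolding set_mult_def by blast
next
  fix y assume "y \<in> (m_inv G ` F) <#> B"
  then obtain u x where u: "u \<in> F" "x \<in> B" "y = inv u \<otimes> x" unfolding set_mult_def by blast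
  then have "x = u \<otimes> y" "x \<in> carrier G" "y \<in> carrier G" using assms by (auto simp: subset_iff)
  then have "(x, y) \<in> finitary_entourage G F"
    using u unfolding finitary_entourage_def r_coset_def by blast
  then show "y \<in> finitary_entourage G F `` B" using u by blast
qed

lemma set_mult_singleton_right: "F <#> {x} = F #> x"
  by (auto simp: set_mult_def r_coset_def)

lemma inv_image_inv_image:
  "F \<subseteq> carrier G \<Longrightarrow> m_inv G ` m_inv G ` F = F"
  by (force simp: image_iff subset_iff)

lemma finitary_entourage_in_coarse:
  assumes "F \<subseteq> carrier G" "finite F" "\<one> \<in> F"
  shows "finitary_entourage G F \<in> finitary_coarse G"
  using coarse_base_finitary assms unfolding coarse_base_def finitary_base_def by blast

text \<open>Macro-uniformity can be tested on the bases of both coarse structures. Passing to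
  inverses and adding \<open>\<one>\<close> turns an arbitrary finite set into one that defines a
  basic entourage.\<close>

lemma selector_iff:
  assumes \<F>: "\<F> \<subseteq> nonempty_subsets (carrier G)"
  shows "selector (carrier G) (finitary_coarse G) \<F> f \<longleftrightarrow>
    (\<forall>A\<in>\<F>. f A \<in> A) \<and>
    (\<forall>F. finite F \<longrightarrow> F \<subseteq> carrier G \<longrightarrow>
      (\<exists>K. finite K \<and> K \<subseteq> carrier G \<and>
        (\<forall>A\<in>\<F>. \<forall>B\<in>\<F>. A \<subseteq> F <#> B \<longrightarrow> B \<subseteq> F <#> A \<longrightarrow> f B \<in> K #> f A)))"
    (is "?L \<longleftrightarrow> ?mem \<and> ?R")
proof
  assume L: ?L
  then have mem: ?mem and mu: "macro_uniform \<F> (coarse_subspace \<F>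
      (hyperballean (carrier G) (finitary_coarse G))) (carrier G) (finitary_coarse G) f"
    by (auto simp: selector_def)
  have ?R
  proof (intro allI impI)
    fix F assume F: "finite F" "F \<subseteq> carrier G"
    define F' where "F' = insert \<one> (m_inv G ` F)"
    have F': "F' \<subseteq> carrier G" "finite F'" "\<one> \<in> F'" using F by (auto simp: F'_def)
    have FF': "F \<subseteq> m_inv G ` F'" using inv_image_inv_image[OF F(2)] unfolding F'_def by blast
    let ?E = "exp_entourage (carrier G) (finitary_entourage G F')"
    have "?E \<in> hyperballean (carrier G) (finitary_coarse G)"
      using coarse_base_hyperballean[OF coarse_structure_finitary]
        finitary_entourage_in_coarse[OF F'] unfolding coarse_base_def by blast
    then have "?E \<inter> (\<F> \<times> \<F>) \<in>
        coarse_subspace \<F> (hyperballean (carrier G) (finitary_coarse G))"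
      unfolding coarse_subspace_def by blast
    then obtain E' where E': "E' \<in> finitary_coarse G"
      "\<And>A. A \<in> \<F> \<Longrightarrow> f ` ((?E \<inter> (\<F> \<times> \<F>)) `` {A}) \<subseteq> E' `` {f A}"
      using mu unfolding macro_uniform_def by meson
    then obtain K where K: "K \<subseteq> carrier G" "finite K" "E' \<subseteq> finitary_entourage G K"
      using coarse_base_finitary unfolding coarse_base_def finitary_base_def by blast
    have "f B \<in> (m_inv G ` K) #> f A"
      if AB: "A \<in> \<F>" "B \<in> \<F>" "A \<subseteq> F <#> B" "B \<subseteq> F <#> A" for A B
    proof -
      have sub: "A \<subseteq> carrier G" "B \<subseteq> carrier G" "A \<noteq> {}" "B \<noteq> {}"
        using AB \<F> by (auto simp: nonempty_subsets_def)
      have "F <#> C \<subseteq> finitary_entourage G F' `` C" if "C \<subseteq> carrier G" for C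
        unfolding finitary_entourage_Image[OF F'(1) that]
        using mono_set_mult[OF FF' order_refl] .
      then have "(A, B) \<in> ?E"
        using sub AB unfolding exp_entourage_def nonempty_subsets_def by blast
      then have "f B \<in> f ` ((?E \<inter> (\<F> \<times> \<F>)) `` {A})" using AB by blast
      then have "f B \<in> E' `` {f A}" using E'(2)[OF AB(1)] by blast
      then have "f B \<in> finitary_entourage G K `` {f A}" using K by blast
      moreover have "{f A} \<subseteq> carrier G" using mem AB sub by blast
      ultimately show ?thesis
        using finitary_entourage_Image[OF K(1), of "{f A}"] unfolding set_mult_singleton_right
        by blast
    qed
    moreover have "finite (m_inv G ` K)" "m_inv G ` K \<subseteq> carrier G" using K by auto
    ultimately show "\<exists>K. finite K \<and> K \<subseteq> carrier G \<and>
        (\<forall>A\<in>\<F>. \<forall>B\<in>\<F>. A \<subseteq> F <#> B \<longrightarrow> B \<subseteq> F <#> A \<longrightarrow> f B \<in> K #> f A)" by blast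
  qed
  with mem show "?mem \<and> ?R" by blast
next
  assume R: "?mem \<and> ?R"
  then have memR: "\<And>A. A \<in> \<F> \<Longrightarrow> f A \<in> A" by simp
  have "macro_uniform \<F> (coarse_subspace \<F>
      (hyperballean (carrier G) (finitary_coarse G))) (carrier G) (finitary_coarse G) f"
    unfolding macro_uniform_def
  proof (intro conjI ballI)
    show "f \<in> \<F> \<rightarrow> carrier G" using memR \<F> by (auto simp: nonempty_subsets_def)
  next
    fix E assume "E \<in> coarse_subspace \<F> (hyperballean (carrier G) (finitary_coarse G))"
    then obtain E0 where E0: "E0 \<in> hyperballean (carrier G) (finitary_coarse G)"
      "E = E0 \<inter> (\<F> \<times> \<F>)" unfolding coarse_subspace_def by blast
    then obtain E1 where E1: "E1 \<in> finitary_coarse G" "E0 \<subseteq> exp_entourage (carrier G) E1"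
      using coarse_base_hyperballean[OF coarse_structure_finitary] unfolding coarse_base_def by blast
    then obtain F where F: "F \<subseteq> carrier G" "finite F" "E1 \<subseteq> finitary_entourage G F"
      using coarse_base_finitary unfolding coarse_base_def finitary_base_def by blast
    then have "finite (m_inv G ` F)" "m_inv G ` F \<subseteq> carrier G" by auto
    then obtain K where K: "finite K" "K \<subseteq> carrier G"
      "\<And>A B. \<lbrakk>A \<in> \<F>; B \<in> \<F>; A \<subseteq> m_inv G ` F <#> B; B \<subseteq> m_inv G ` F <#> A\<rbrakk>
        \<Longrightarrow> f B \<in> K #> f A"
      using R by meson
    define K' where "K' = insert \<one> (m_inv G ` K)"
    have K': "K' \<subseteq> carrier G" "finite K'" "\<one> \<in> K'" using K by (auto simp: K'_def)
    have KK': "K \<subseteq> m_inv G ` K'" using inv_image_inv_image[OF K(2)] unfolding K'_def by blast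
    have "f ` (E `` {A}) \<subseteq> finitary_entourage G K' `` {f A}" if A: "A \<in> \<F>" for A
    proof
      fix z assume "z \<in> f ` (E `` {A})"
      then obtain B where B: "(A, B) \<in> E" "z = f B" by blast
      then have AB: "B \<in> \<F>" "(A, B) \<in> exp_entourage (carrier G) E1" using E0 E1 by auto
      then have sub: "A \<subseteq> carrier G" "B \<subseteq> carrier G"
        by (auto simp: exp_entourage_def nonempty_subsets_def)
      have "A \<subseteq> finitary_entourage G F `` B" "B \<subseteq> finitary_entourage G F `` A"
        using AB F(3) unfolding exp_entourage_def by blast+
      then have "f B \<in> K #> f A"
        using K(3)[OF A AB(1)] finitary_entourage_Image[OF F(1)] sub by simp
      then have "f B \<in> m_inv G ` K' #> f A" using KK' by (auto simp: r_coset_def)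
      moreover have "{f A} \<subseteq> carrier G" using memR[OF A] sub by blast
      ultimately show "z \<in> finitary_entourage G K' `` {f A}"
        using B finitary_entourage_Image[OF K'(1), of "{f A}"] unfolding set_mult_singleton_right
        by blast
    qed
    then show "\<exists>E'\<in>finitary_coarse G. \<forall>A\<in>\<F>. f ` (E `` {A}) \<subseteq> E' `` {f A}"
      using finitary_entourage_in_coarse[OF K'] by blast
  qed
  then show ?L using R by (simp add: selector_def)
qed

end

subsection \<open>The orientation given by a 2-selector\<close>

text \<open>
  \<open>lt\<close> stands for the orientation of pairs given by a 2-selector, \<open>K s\<close> for the finite set outside of
  which the distance \<open>x \<otimes> inv y\<close> of a pair has to stay for a step by \<open>s\<close> not to change its orientation.
\<close>

locale oriented_group = group +
  fixes lt :: "'a \<Rightarrow> 'a \<Rightarrow> bool" and K :: "'a \<Rightarrow> 'a set"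
  assumes lt_swap: "\<lbrakk>x \<in> carrier G; y \<in> carrier G; x \<noteq> y\<rbrakk> \<Longrightarrow> lt y x \<longleftrightarrow> \<not> lt x y"
    and K_carrier: "s \<in> carrier G \<Longrightarrow> K s \<subseteq> carrier G"
    and K_finite: "s \<in> carrier G \<Longrightarrow> finite (K s)"
    and lt_step_left: "\<lbrakk>s \<in> carrier G; x \<in> carrier G; y \<in> carrier G; x \<otimes> inv y \<notin> K s\<rbrakk>
      \<Longrightarrow> lt (s \<otimes> x) y \<longleftrightarrow> lt x y"
    and lt_step_right: "\<lbrakk>s \<in> carrier G; x \<in> carrier G; y \<in> carrier G; x \<otimes> inv y \<notin> K s\<rbrakk>
      \<Longrightarrow> lt x (s \<otimes> y) \<longleftrightarrow> lt x y"

context group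
begin

text \<open>The pairs \<open>{x, y}\<close> and \<open>{s \<otimes> x, y}\<close> are close, so
  their selected points are close; when \<open>x\<close> and \<open>y\<close> are far apart, the
  selection cannot jump from one to the other.\<close>

lemma two_selector_oriented:
  assumes f: "selector (carrier G) (finitary_coarse G) (two_subsets (carrier G)) f"
  shows "\<exists>lt K. oriented_group G lt K"
proof -
  let ?T = "two_subsets (carrier G)"
  have T: "{x, y} \<in> ?T" if "x \<in> carrier G" "y \<in> carrier G" "x \<noteq> y" for x y
    using that by (auto simp: two_subsets_def)
  have "?T \<subseteq> nonempty_subsets (carrier G)"
    by (auto simp: two_subsets_def nonempty_subsets_def)
  note sel = f[unfolded selector_iff[OF this]]
  have mem: "\<And>A. A \<in> ?T \<Longrightarrow> f A \<in> A"
    and close: "\<And>F. \<lbrakk>finite F; F \<subseteq> carrier G\<rbrakk> \<Longrightarrow> \<exists>K. finite K \<and> K \<subseteq> carrier G \<and>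
        (\<forall>A\<in>?T. \<forall>B\<in>?T. A \<subseteq> F <#> B \<longrightarrow> B \<subseteq> F <#> A \<longrightarrow> f B \<in> K #> f A)"
    using sel by simp_all
  define lt where "lt x y \<longleftrightarrow> f {x, y} = x" for x y
  have swap: "lt y x \<longleftrightarrow> \<not> lt x y" if "x \<in> carrier G" "y \<in> carrier G" "x \<noteq> y" for x y
    using mem[OF T[OF that]] that by (auto simp: lt_def insert_commute)
  have "\<exists>K. finite K \<and> K \<subseteq> carrier G \<and>
      (\<forall>x\<in>carrier G. \<forall>y\<in>carrier G. x \<otimes> inv y \<notin> K \<longrightarrow>
        x \<noteq> y \<and> s \<otimes> x \<noteq> y \<and> x \<noteq> s \<otimes> y \<and> (lt (s \<otimes> x) y \<longleftrightarrow> lt x y))"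
    if s: "s \<in> carrier G" for s
  proof -
    obtain L where L: "finite L" "L \<subseteq> carrier G"
      "\<And>A B. \<lbrakk>A \<in> ?T; B \<in> ?T; A \<subseteq> {\<one>, s, inv s} <#> B; B \<subseteq> {\<one>, s, inv s} <#> A\<rbrakk>
        \<Longrightarrow> f B \<in> L #> f A"
      using close[of "{\<one>, s, inv s}"] s by auto
    \<comment> \<open>The three parts exclude coincidences between the points involved, a jump from
      \<open>x\<close> to \<open>y\<close> (which gives \<open>y \<otimes> inv x \<in> L\<close>),
      and a jump from \<open>y\<close> to \<open>s \<otimes> x\<close> (which gives
      \<open>s \<otimes> x \<otimes> inv y \<in> L\<close>).\<close>
    define K where "K = {\<one>, s, inv s} \<union> m_inv G ` L \<union> (\<lambda>u. inv s \<otimes> u) ` L"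
    have "x \<noteq> y \<and> s \<otimes> x \<noteq> y \<and> x \<noteq> s \<otimes> y \<and> (lt (s \<otimes> x) y \<longleftrightarrow> lt x y)"
      if xy: "x \<in> carrier G" "y \<in> carrier G" and far: "x \<otimes> inv y \<notin> K" for x y
    proof -
      have "x \<noteq> y" "x \<noteq> s \<otimes> y" using far xy s by (auto simp: K_def m_assoc)
      moreover have ne: "s \<otimes> x \<noteq> y"
        using far xy s by (auto simp: K_def inv_mult_group)
      moreover have "lt (s \<otimes> x) y \<longleftrightarrow> lt x y"
      proof -
        have eq: "{\<one>, s, inv s} <#> {x, y} = {x, y, s \<otimes> x, s \<otimes> y, inv s \<otimes> x, inv s \<otimes> y}"
          "{\<one>, s, inv s} <#> {s \<otimes> x, y} =
            {s \<otimes> x, y, s \<otimes> (s \<otimes> x), s \<otimes> y, x, inv s \<otimes> y}"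
          using xy s by (auto simp: set_mult_def)
        have f: "f {s \<otimes> x, y} \<in> L #> f {x, y}"
          by (rule L(3)) (use T xy s \<open>x \<noteq> y\<close> ne in \<open>auto simp: eq\<close>)
        have m: "f {x, y} \<in> {x, y}" "f {s \<otimes> x, y} \<in> {s \<otimes> x, y}"
          using mem[OF T[of x y]] mem[OF T[of "s \<otimes> x" y]] xy s \<open>x \<noteq> y\<close> ne by simp_all
        have False if "f {x, y} = x" "f {s \<otimes> x, y} = y"
        proof -
          have "y \<otimes> inv x \<in> L" using f that mem_r_coset_iff[OF L(2)] xy by simp
          moreover have "x \<otimes> inv y = inv (y \<otimes> inv x)" using xy by (simp add: inv_mult_group)
          ultimately show False using far by (auto simp: K_def)
        qed
        moreover have False if "f {x, y} = y" "f {s \<otimes> x, y} = s \<otimes> x"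
        proof -
          have "s \<otimes> x \<otimes> inv y \<in> L" using f that mem_r_coset_iff[OF L(2)] xy s by simp
          moreover have "x \<otimes> inv y = inv s \<otimes> (s \<otimes> x \<otimes> inv y)"
            using xy s by (simp add: m_assoc)
          ultimately show False using far by (auto simp: K_def)
        qed
        ultimately show ?thesis using m ne \<open>x \<noteq> y\<close> by (auto simp: lt_def)
      qed
      ultimately show ?thesis by blast
    qed
    moreover have "finite K" "K \<subseteq> carrier G" using L s by (auto simp: K_def)
    ultimately show ?thesis by blast
  qed
  then obtain K0 where K0: "\<And>s. s \<in> carrier G \<Longrightarrow> finite (K0 s)"
    "\<And>s. s \<in> carrier G \<Longrightarrow> K0 s \<subseteq> carrier G"
    "\<And>s x y. \<lbrakk>s \<in> carrier G; x \<in> carrier G; y \<in> carrier G; x \<otimes> inv y \<notin> K0 s\<rbrakk> \<Longrightarrow>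
        x \<noteq> y \<and> s \<otimes> x \<noteq> y \<and> x \<noteq> s \<otimes> y \<and> (lt (s \<otimes> x) y \<longleftrightarrow> lt x y)"
    by metis
  \<comment> \<open>Inverses are added because a step of the right point is a step of the left point
    in the swapped pair, whose quotient is the inverse one.\<close>
  define K where "K s = K0 s \<union> m_inv G ` K0 s" for s
  have "oriented_group G lt K"
  proof unfold_locales
    show "lt y x \<longleftrightarrow> \<not> lt x y" if "x \<in> carrier G" "y \<in> carrier G" "x \<noteq> y" for x y
      by (rule swap[OF that])
    show "finite (K s)" if "s \<in> carrier G" for s using K0(1)[OF that] by (simp add: K_def)
    show "K s \<subseteq> carrier G" if "s \<in> carrier G" for s using K0(2)[OF that] by (auto simp: K_def)
    show "lt (s \<otimes> x) y \<longleftrightarrow> lt x y"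
      if "s \<in> carrier G" "x \<in> carrier G" "y \<in> carrier G" "x \<otimes> inv y \<notin> K s" for s x y
      using K0(3)[of s x y] that by (simp add: K_def)
    show "lt x (s \<otimes> y) \<longleftrightarrow> lt x y"
      if sxy: "s \<in> carrier G" "x \<in> carrier G" "y \<in> carrier G" and far: "x \<otimes> inv y \<notin> K s" for s x y
    proof -
      have "y \<otimes> inv x \<notin> K0 s"
      proof
        assume "y \<otimes> inv x \<in> K0 s"
        then have "inv (y \<otimes> inv x) \<in> K s" by (auto simp: K_def)
        then show False using far sxy by (simp add: inv_mult_group)
      qed
      then have "y \<noteq> x" "s \<otimes> y \<noteq> x" "lt (s \<otimes> y) x \<longleftrightarrow> lt y x" using K0(3)[of s y x] sxy by auto
      then show ?thesis using swap[of x y] swap[of x "s \<otimes> y"] sxy by auto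
    qed
  qed
  then show ?thesis by blast
qed

end

context oriented_group
begin

text \<open>Lying in different cosets of \<open>L\<close> is preserved when either point is
  multiplied on the left by an element of \<open>L\<close>, and it keeps the quotient out of every
  \<open>K s\<close>. So words of any length in \<open>S\<close> can be followed.\<close>

lemma lt_generate:
  assumes S: "S \<subseteq> carrier G" and L: "subgroup L G" "S \<subseteq> L" "\<Union>(K ` S) \<subseteq> L"
    and h: "h \<in> generate G S"
    and xy: "x \<in> carrier G" "y \<in> carrier G" "x \<otimes> inv y \<notin> L"
  shows "lt (h \<otimes> x) y \<longleftrightarrow> lt x y" "lt x (h \<otimes> y) \<longleftrightarrow> lt x y"
proof -
  have LG: "L \<subseteq> carrier G" using L(1) by (rule subgroup.subset)
  have mult: "h \<otimes> (x \<otimes> inv y) \<notin> L" "x \<otimes> inv y \<otimes> h \<notin> L"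
    if "h \<in> L" "x \<in> carrier G" "y \<in> carrier G" "x \<otimes> inv y \<notin> L" for h x y
  proof -
    have "h \<in> carrier G" using LG that by blast
    then have e: "inv h \<otimes> (h \<otimes> (x \<otimes> inv y)) = x \<otimes> inv y"
        "x \<otimes> inv y \<otimes> h \<otimes> inv h = x \<otimes> inv y" using that by (simp_all add: m_assoc)
    have "inv h \<in> L" using that L(1) by (simp add: subgroup.m_inv_closed)
    then show "h \<otimes> (x \<otimes> inv y) \<notin> L" "x \<otimes> inv y \<otimes> h \<notin> L"
      using e that(4) subgroup.m_closed[OF L(1)] by metis+
  qed
  have genL: "generate G S \<subseteq> L" using generate_subgroup_incl[OF L(2,1)] .
  have "\<forall>x\<in>carrier G. \<forall>y\<in>carrier G. x \<otimes> inv y \<notin> L \<longrightarrow>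
      (lt (h \<otimes> x) y \<longleftrightarrow> lt x y) \<and> (lt x (h \<otimes> y) \<longleftrightarrow> lt x y)"
    using h
  proof induction
    case one
    then show ?case by simp
  next
    case (incl s)
    show ?case
    proof (intro ballI impI)
      fix x y assume xy: "x \<in> carrier G" "y \<in> carrier G" "x \<otimes> inv y \<notin> L"
      have "s \<in> carrier G" "x \<otimes> inv y \<notin> K s" using incl S L(3) xy by auto
      then show "(lt (s \<otimes> x) y \<longleftrightarrow> lt x y) \<and> (lt x (s \<otimes> y) \<longleftrightarrow> lt x y)"
        using lt_step_left lt_step_right xy by simp
    qed
  next
    case (inv s)
    show ?case
    proof (intro ballI impI)
      fix x y assume xy: "x \<in> carrier G" "y \<in> carrier G" "x \<otimes> inv y \<notin> L"
      have s: "s \<in> carrier G" "s \<in> L" "inv s \<in> L" "K s \<subseteq> L"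
        using inv S L by (auto simp: subgroup.m_inv_closed)
      \<comment> \<open>A step by \<open>inv s\<close> is a step by \<open>s\<close> read backwards,
        so the threshold \<open>K s\<close> is applied to the point already moved.\<close>
      have "inv s \<otimes> x \<otimes> inv y \<notin> K s" "x \<otimes> inv (inv s \<otimes> y) \<notin> K s"
        using mult(1)[OF s(3) xy] mult(2)[OF s(2) xy] s xy by (auto simp: m_assoc inv_mult_group)
      then show "(lt (inv s \<otimes> x) y \<longleftrightarrow> lt x y) \<and> (lt x (inv s \<otimes> y) \<longleftrightarrow> lt x y)"
        using lt_step_left[of s "inv s \<otimes> x" y] lt_step_right[of s x "inv s \<otimes> y"] s xy by simp
    qed
  next
    case (eng h1 h2)
    show ?case
    proof (intro ballI impI)
      fix x y assume xy: "x \<in> carrier G" "y \<in> carrier G" "x \<otimes> inv y \<notin> L"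
      have h: "h1 \<in> L" "h2 \<in> L" "inv h2 \<in> L" "h1 \<in> carrier G" "h2 \<in> carrier G"
        using eng genL LG L(1) by (auto simp: subgroup.m_inv_closed)
      have "h2 \<otimes> x \<otimes> inv y \<notin> L" "x \<otimes> inv (h2 \<otimes> y) \<notin> L"
        using mult[OF h(2) xy] mult[OF h(3) xy] h xy by (auto simp: m_assoc inv_mult_group)
      then show "(lt (h1 \<otimes> h2 \<otimes> x) y \<longleftrightarrow> lt x y) \<and> (lt x (h1 \<otimes> h2 \<otimes> y) \<longleftrightarrow> lt x y)"
        using eng.IH xy h by (simp add: m_assoc)
    qed
  qed
  then show "lt (h \<otimes> x) y \<longleftrightarrow> lt x y" "lt x (h \<otimes> y) \<longleftrightarrow> lt x y" using xy by blast+
qed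

text \<open>
  For \<open>g\<close> outside of the subgroup \<open>L\<close> generated by \<open>S \<union> \<Union>(K ` S)\<close>, two points in different cosets of
  \<open>L\<close> move freely within their cosets of \<open>H\<close>, and steps by \<open>g\<close> are allowed for all but finitely many
  \<open>h, k \<in> H\<close>. With \<open>c h = inv g \<otimes> h \<otimes> g\<close>, the pairs
  \<open>(\<one>, h g)\<close>, \<open>(\<one>, c h)\<close>, \<open>(g, c h)\<close>, \<open>(k g, c h)\<close>, \<open>(c k, c h)\<close>, \<open>(c k, h g)\<close>, \<open>(c k, g)\<close>, \<open>(c k, \<one>)\<close>,
  \<open>(k g, \<one>)\<close>, \<open>(h g, \<one>)\<close> then all have the same orientation.
\<close>

lemma generate_K_eq_carrier:
  assumes S: "S \<subseteq> carrier G" and inf: "infinite (generate G S)"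
  shows "generate G (S \<union> \<Union>(K ` S)) = carrier G"
proof (rule ccontr)
  define H where "H = generate G S"
  define L where "L = generate G (S \<union> \<Union>(K ` S))"
  assume "generate G (S \<union> \<Union>(K ` S)) \<noteq> carrier G"
  moreover have SK: "S \<union> \<Union>(K ` S) \<subseteq> carrier G" using S K_carrier by blast
  ultimately obtain g where g: "g \<in> carrier G" "g \<notin> L"
    using generate_incl[OF SK] unfolding L_def by blast
  have L: "subgroup L G" unfolding L_def by (rule generate_is_subgroup[OF SK])
  have SL: "S \<subseteq> L" "\<Union>(K ` S) \<subseteq> L" unfolding L_def by (auto intro: generate.incl)
  have H: "subgroup H G" unfolding H_def by (rule generate_is_subgroup[OF S])
  have HL: "H \<subseteq> L" unfolding H_def by (rule generate_subgroup_incl[OF SL(1) L])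
  have HG: "H \<subseteq> carrier G" using H by (rule subgroup.subset)
  note moves = lt_generate[OF S L SL, folded H_def]
  have g': "inv g \<notin> L" using subgroup.m_inv_closed[OF L, of "inv g"] g by auto
  have Lmult: "u \<otimes> g \<notin> L" "g \<otimes> u \<notin> L" "inv g \<otimes> u \<notin> L" if "u \<in> H" for u
  proof -
    have u: "u \<in> L" "inv u \<in> L" "u \<in> carrier G"
      using that HL HG subgroup.m_inv_closed[OF L] by auto
    have e: "inv u \<otimes> (u \<otimes> g) = g" "g \<otimes> u \<otimes> inv u = g" "inv g \<otimes> u \<otimes> inv u = inv g"
      using u g by (simp_all add: m_assoc)
    show "u \<otimes> g \<notin> L" "g \<otimes> u \<notin> L" "inv g \<otimes> u \<notin> L"
      using subgroup.m_closed[OF L] u e g g' by metis+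
  qed
  have fin: "finite {h \<in> H. \<phi> h \<in> T}" if "inj_on \<phi> H" "finite T" for \<phi> :: "'a \<Rightarrow> 'a" and T
    using finite_vimage_IntI[OF that(2,1)] by (rule finite_subset[rotated]) blast
  have avoid: "\<exists>h\<in>H. h \<notin> T" if "finite T" for T
    using inf finite_subset[OF _ that, of H] unfolding H_def by blast
  have Kg: "finite (K g)" "finite (K (inv g))" using g by (simp_all add: K_finite)
  define c where "c h = inv g \<otimes> (h \<otimes> g)" for h
  have cG: "c h \<in> carrier G" if "h \<in> H" for h using that HG g by (auto simp: c_def)
  have inj: "inj_on (\<lambda>h. u \<otimes> h \<otimes> v) H" if "u \<in> carrier G" "v \<in> carrier G" for u v
    using that HG by (auto simp: inj_on_def subset_iff)
  have "finite ({h \<in> H. inv (h \<otimes> g) \<in> K (inv g)} \<union> {h \<in> H. inv (c h) \<in> K g})"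
  proof (intro finite_UnI fin)
    show "inj_on (\<lambda>h. inv (h \<otimes> g)) H" "inj_on (\<lambda>h. inv (c h)) H"
      using HG g by (auto simp: inj_on_def subset_iff c_def inv_mult_group)
  qed (rule Kg)+
  from avoid[OF this] obtain h where h: "h \<in> H" "inv (h \<otimes> g) \<notin> K (inv g)" "inv (c h) \<notin> K g"
    by auto
  \<comment> \<open>\<open>h\<close> is fixed first since two of these conditions on
    \<open>k\<close> involve \<open>c h\<close>; each condition excludes only finitely many
    \<open>k\<close> by injectivity.\<close>
  have "finite ({k \<in> H. k \<otimes> g \<otimes> inv (c h) \<in> K (inv g)} \<union> {k \<in> H. c k \<otimes> inv (c h) \<in> K g} \<union>
      {k \<in> H. c k \<otimes> inv g \<in> K (inv g)} \<union> {k \<in> H. c k \<in> K g})"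
  proof (intro finite_UnI fin)
    show "inj_on (\<lambda>k. k \<otimes> g \<otimes> inv (c h)) H" "inj_on (\<lambda>k. c k \<otimes> inv (c h)) H"
      "inj_on (\<lambda>k. c k \<otimes> inv g) H" "inj_on c H"
      using HG g cG h(1) by (auto simp: inj_on_def subset_iff c_def)
  qed (rule Kg)+
  from avoid[OF this] obtain k where k: "k \<in> H" "k \<otimes> g \<otimes> inv (c h) \<notin> K (inv g)" "c k \<otimes> inv (c h) \<notin> K g"
      "c k \<otimes> inv g \<notin> K (inv g)" "c k \<notin> K g"
    by auto
  have G: "h \<in> carrier G" "k \<in> carrier G" "c h \<in> carrier G" "c k \<in> carrier G"
    using h k HG cG by auto
  have gc: "g \<otimes> c u = u \<otimes> g" if "u \<in> H" for u
    using that HG g by (auto simp: c_def)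
  have Hinv: "inv u \<in> H" if "u \<in> H" for u using subgroup.m_inv_closed[OF H that] .
  have "lt \<one> (h \<otimes> g) \<longleftrightarrow> lt \<one> (c h)"
    using lt_step_right[of "inv g" \<one> "h \<otimes> g"] h(2) g G by (simp add: c_def)
  also have "\<dots> \<longleftrightarrow> lt g (c h)"
    using lt_step_left[of g \<one> "c h"] h(3) g G by simp
  also have "\<dots> \<longleftrightarrow> lt (k \<otimes> g) (c h)"
  proof -
    have "g \<otimes> inv (c h) = g \<otimes> (inv g \<otimes> inv h \<otimes> g)" using g G by (simp add: c_def inv_mult_group)
    also have "\<dots> = inv h \<otimes> g" using g G by (simp add: m_assoc)
    finally show ?thesis using moves(1)[OF k(1), of g "c h"] Lmult(1)[OF Hinv[OF h(1)]] g G by simp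
  qed
  also have "\<dots> \<longleftrightarrow> lt (c k) (c h)"
    using lt_step_left[of "inv g" "k \<otimes> g" "c h"] k(2) g G by (simp add: c_def)
  also have "\<dots> \<longleftrightarrow> lt (c k) (h \<otimes> g)"
    using lt_step_right[of g "c k" "c h"] k(3) g G by (simp add: gc h)
  also have "\<dots> \<longleftrightarrow> lt (c k) g"
  proof -
    have "c k \<otimes> inv g = inv g \<otimes> k" using g G by (simp add: c_def m_assoc)
    then show ?thesis using moves(2)[OF h(1), of "c k" g] Lmult(3)[OF k(1)] g G by simp
  qed
  also have "\<dots> \<longleftrightarrow> lt (c k) \<one>"
    using lt_step_right[of "inv g" "c k" g] k(4) g G by simp
  also have "\<dots> \<longleftrightarrow> lt (k \<otimes> g) \<one>"
    using lt_step_left[of g "c k" \<one>] k(5) g G by (simp add: gc k)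
  also have "\<dots> \<longleftrightarrow> lt g \<one>"
    using moves(1)[OF k(1), of g \<one>] g by simp
  also have "\<dots> \<longleftrightarrow> lt (h \<otimes> g) \<one>"
    using moves(1)[OF h(1), of g \<one>] g by simp
  finally have "lt \<one> (h \<otimes> g) \<longleftrightarrow> lt (h \<otimes> g) \<one>" .
  moreover have "\<one> \<noteq> h \<otimes> g" using Lmult(1)[OF h(1)] subgroup.one_closed[OF L] by metis
  ultimately show False using lt_swap[of \<one> "h \<otimes> g"] g G by simp
qed

end

section \<open>Countability of groups with a 2-selector\<close>

lemma (in group) countable_generate:
  assumes "S \<subseteq> carrier G" "countable S"
  shows "countable (generate G S)"
proof -
  let ?f = "\<lambda>xs. foldr (\<otimes>) xs \<one>"
  let ?L = "lists (S \<union> m_inv G ` S)"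
  have closed: "?f xs \<in> carrier G" if "xs \<in> ?L" for xs
    using that assms by (induction xs) auto
  have app: "?f (xs @ ys) = ?f xs \<otimes> ?f ys" if "xs \<in> ?L" "ys \<in> ?L" for xs ys
    using that
  proof (induction xs)
    case (Cons x xs)
    then have "x \<in> carrier G" using assms by auto
    then show ?case using Cons closed[of xs] closed[of ys] by (simp add: m_assoc)
  qed (use closed in simp)
  have "generate G S \<subseteq> ?f ` ?L"
  proof
    fix h assume "h \<in> generate G S"
    then show "h \<in> ?f ` ?L"
    proof induction
      case one
      show ?case by (rule image_eqI[of _ _ "[]"]) auto
    next
      case (incl h)
      then show ?case using assms by (intro image_eqI[of _ _ "[h]"]) auto
    next
      case (inv h)
      then show ?case using assms by (intro image_eqI[of _ _ "[inv h]"]) auto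
    next
      case (eng h1 h2)
      then obtain xs ys where "xs \<in> ?L" "ys \<in> ?L" "h1 = ?f xs" "h2 = ?f ys" by blast
      then show ?case using app by (intro image_eqI[of _ _ "xs @ ys"]) auto
    qed
  qed
  moreover have "countable (?f ` ?L)" using assms by (intro countable_image countable_lists) simp
  ultimately show ?thesis by (rule countable_subset)
qed

text \<open>A countably infinite subset together with its finite thresholds already generates the
  group.\<close>

lemma (in oriented_group) countable_carrier: "countable (carrier G)"
proof (cases "finite (carrier G)")
  case True
  then show ?thesis by (rule countable_finite)
next
  case False
  then obtain S where S: "S \<subseteq> carrier G" "countable S" "infinite S"
    using infinite_countable_subset' by blast
  have "S \<subseteq> generate G S" by (auto intro: generate.incl)
  then have "infinite (generate G S)" using S(3) finite_subset by blast
  from generate_K_eq_carrier[OF S(1) this]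
  have "carrier G = generate G (S \<union> \<Union>(K ` S))" ..
  also have "countable \<dots>"
  proof (rule countable_generate)
    show "S \<union> \<Union>(K ` S) \<subseteq> carrier G" using S K_carrier by blast
    show "countable (S \<union> \<Union>(K ` S))"
      using S K_finite by (intro countable_Un countable_UN) (auto intro: countable_finite)
  qed
  finally show ?thesis .
qed

subsection \<open>Almost invariant sets\<close>

text \<open>The almost invariant sets of the theory of ends. As \<open>k\<close> runs over inverses
  too, the points entering \<open>A\<close> are controlled along with those leaving it. In a
  finitely generated group the condition amounts to a finite boundary in the Cayley graph.\<close>

definition (in group) almost_invariant :: "'a set \<Rightarrow> bool" where
  "almost_invariant A \<longleftrightarrow>
     A \<subseteq> carrier G \<and> (\<forall>k\<in>carrier G. finite {x \<in> A. k \<otimes> x \<notin> A})"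

context group
begin

lemma almost_invariant_carrier: "almost_invariant A \<Longrightarrow> A \<subseteq> carrier G"
  by (simp add: almost_invariant_def)

lemma almost_invariantD:
  "almost_invariant A \<Longrightarrow> k \<in> carrier G \<Longrightarrow> finite {x \<in> A. k \<otimes> x \<notin> A}"
  by (simp add: almost_invariant_def)

lemma almost_invariant_finite:
  "finite A \<Longrightarrow> A \<subseteq> carrier G \<Longrightarrow> almost_invariant A"
  by (simp add: almost_invariant_def)

lemma almost_invariant_Int:
  assumes "almost_invariant A" "almost_invariant B"
  shows "almost_invariant (A \<inter> B)"
  unfolding almost_invariant_def
proof (intro conjI ballI)
  show "A \<inter> B \<subseteq> carrier G" using assms(1) by (auto simp: almost_invariant_def)
  fix k assume k: "k \<in> carrier G"
  show "finite {x \<in> A \<inter> B. k \<otimes> x \<notin> A \<inter> B}"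
    by (rule finite_subset[of _ "{x \<in> A. k \<otimes> x \<notin> A} \<union> {x \<in> B. k \<otimes> x \<notin> B}"])
      (use assms[THEN almost_invariantD, OF k] in auto)
qed

text \<open>A point leaving the complement under \<open>k\<close> lands on a point of
  \<open>A\<close> that leaves \<open>A\<close> under \<open>inv k\<close>.\<close>

lemma almost_invariant_compl:
  assumes "almost_invariant A"
  shows "almost_invariant (carrier G - A)"
  unfolding almost_invariant_def
proof (intro conjI ballI)
  fix k assume k: "k \<in> carrier G"
  have "{x \<in> carrier G - A. k \<otimes> x \<notin> carrier G - A} \<subseteq>
      (\<lambda>z. inv k \<otimes> z) ` {z \<in> A. inv k \<otimes> z \<notin> A}"
  proof
    fix x assume "x \<in> {x \<in> carrier G - A. k \<otimes> x \<notin> carrier G - A}"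
    then have "x \<in> carrier G" "k \<otimes> x \<in> A" "x \<notin> A" "x = inv k \<otimes> (k \<otimes> x)"
      using k by auto
    then show "x \<in> (\<lambda>z. inv k \<otimes> z) ` {z \<in> A. inv k \<otimes> z \<notin> A}"
      by (intro image_eqI[of _ _ "k \<otimes> x"]) auto
  qed
  then show "finite {x \<in> carrier G - A. k \<otimes> x \<notin> carrier G - A}"
    using almost_invariantD[OF assms, of "inv k"] k finite_surj by auto
qed simp

lemma almost_invariant_Diff:
  assumes "almost_invariant A" "almost_invariant B"
  shows "almost_invariant (A - B)"
proof -
  have "A - B = A \<inter> (carrier G - B)" using almost_invariant_carrier[OF assms(1)] by blast
  then show ?thesis using almost_invariant_Int almost_invariant_compl assms by metis
qed

lemma almost_invariant_r_coset:
  assumes "almost_invariant A" "w \<in> carrier G"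
  shows "almost_invariant (A #> w)"
  unfolding almost_invariant_def
proof (intro conjI ballI)
  have A: "A \<subseteq> carrier G" using assms(1) by (rule almost_invariant_carrier)
  show "A #> w \<subseteq> carrier G" by (rule r_coset_subset_G[OF A assms(2)])
  fix k assume k: "k \<in> carrier G"
  have "{x \<in> A #> w. k \<otimes> x \<notin> A #> w} \<subseteq> (\<lambda>z. z \<otimes> w) ` {z \<in> A. k \<otimes> z \<notin> A}"
  proof
    fix x assume "x \<in> {x \<in> A #> w. k \<otimes> x \<notin> A #> w}"
    then obtain a where a: "a \<in> A" "x = a \<otimes> w" "k \<otimes> x \<notin> A #> w"
      by (auto simp: r_coset_def)
    then have "k \<otimes> x = (k \<otimes> a) \<otimes> w" using A k assms(2) by (simp add: m_assoc subset_iff)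
    then have "k \<otimes> a \<notin> A" using a(3) by (auto simp: r_coset_def)
    then show "x \<in> (\<lambda>z. z \<otimes> w) ` {z \<in> A. k \<otimes> z \<notin> A}" using a by blast
  qed
  then show "finite {x \<in> A #> w. k \<otimes> x \<notin> A #> w}"
    using almost_invariantD[OF assms(1) k] finite_surj by auto
qed

lemma finite_r_coset_iff:
  assumes "A \<subseteq> carrier G" "w \<in> carrier G"
  shows "finite (A #> w) \<longleftrightarrow> finite A"
proof -
  have "A #> w = (\<lambda>a. a \<otimes> w) ` A" by (auto simp: r_coset_def)
  moreover have "inj_on (\<lambda>a. a \<otimes> w) A" using assms by (auto simp: inj_on_def subset_iff)
  ultimately show ?thesis by (simp add: finite_image_iff)
qed

end

subsection \<open>Connectedness in finitely generated groups\<close>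

locale generated_group = group +
  fixes S :: "'a set"
  assumes S_carrier: "S \<subseteq> carrier G" and S_finite: "finite S"
    and S_inv: "s \<in> S \<Longrightarrow> inv s \<in> S" and S_generate: "generate G S = carrier G"
begin

text \<open>The subgraph of the Cayley graph induced on \<open>A\<close>: paths counted by
  \<open>S_connected\<close> must stay inside \<open>A\<close>.\<close>

definition edges :: "'a set \<Rightarrow> ('a \<times> 'a) set" where
  "edges A = {(x, y). x \<in> A \<and> y \<in> A \<and> (\<exists>s\<in>S. y = s \<otimes> x)}"

definition S_connected :: "'a set \<Rightarrow> bool" where
  "S_connected A \<longleftrightarrow> (\<forall>x\<in>A. \<forall>y\<in>A. (x, y) \<in> (edges A)\<^sup>*)"

definition boundary :: "'a set \<Rightarrow> 'a set" where
  "boundary A = {x \<in> A. \<exists>s\<in>S. s \<otimes> x \<notin> A}"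

lemma edges_mono: "A \<subseteq> B \<Longrightarrow> edges A \<subseteq> edges B"
  by (auto simp: edges_def)

lemma rtrancl_edges_mono: "A \<subseteq> B \<Longrightarrow> (x, y) \<in> (edges A)\<^sup>* \<Longrightarrow> (x, y) \<in> (edges B)\<^sup>*"
  using rtrancl_mono[OF edges_mono] by blast

lemma sym_edges: "A \<subseteq> carrier G \<Longrightarrow> sym (edges A)"
proof (rule symI)
  fix x y assume A: "A \<subseteq> carrier G" and "(x, y) \<in> edges A"
  then obtain s where s: "x \<in> A" "y \<in> A" "s \<in> S" "y = s \<otimes> x" by (auto simp: edges_def)
  then have "x = inv s \<otimes> y" using A S_carrier by (auto simp: subset_iff)
  then show "(y, x) \<in> edges A" using s S_inv unfolding edges_def by blast
qed

lemma rtrancl_edges_sym: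
  "A \<subseteq> carrier G \<Longrightarrow> (x, y) \<in> (edges A)\<^sup>* \<Longrightarrow> (y, x) \<in> (edges A)\<^sup>*"
  using sym_rtrancl[OF sym_edges] by (meson symD)

lemma S_connectedD: "S_connected A \<Longrightarrow> x \<in> A \<Longrightarrow> y \<in> A \<Longrightarrow> (x, y) \<in> (edges A)\<^sup>*"
  by (simp add: S_connected_def)

lemma S_connectedI_center:
  assumes "A \<subseteq> carrier G" "\<And>x. x \<in> A \<Longrightarrow> (c, x) \<in> (edges A)\<^sup>*"
  shows "S_connected A"
  unfolding S_connected_def
proof (intro ballI)
  fix x y assume "x \<in> A" "y \<in> A"
  then have "(x, c) \<in> (edges A)\<^sup>*" "(c, y) \<in> (edges A)\<^sup>*"
    using assms rtrancl_edges_sym by blast+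
  then show "(x, y) \<in> (edges A)\<^sup>*" by (rule rtrancl_trans)
qed

lemma S_connected_Union:
  assumes "\<And>A. A \<in> \<A> \<Longrightarrow> S_connected A \<and> A \<subseteq> carrier G \<and> c \<in> A"
  shows "S_connected (\<Union>\<A>)"
proof (rule S_connectedI_center[of _ c])
  show "\<Union>\<A> \<subseteq> carrier G" using assms by blast
  fix x assume "x \<in> \<Union>\<A>"
  then obtain A where A: "A \<in> \<A>" "x \<in> A" by blast
  then have "(c, x) \<in> (edges A)\<^sup>*" using assms S_connectedD by blast
  then show "(c, x) \<in> (edges (\<Union>\<A>))\<^sup>*" using A rtrancl_edges_mono[of A "\<Union>\<A>"] by blast
qed

lemma S_connected_Un:
  assumes "S_connected A" "S_connected B" "A \<subseteq> carrier G" "B \<subseteq> carrier G" "c \<in> A" "c \<in> B"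
  shows "S_connected (A \<union> B)"
  using S_connected_Union[of "{A, B}" c] assms by auto

lemma rtrancl_edges_generate:
  assumes "h \<in> generate G S" "x \<in> carrier G"
  shows "(x, h \<otimes> x) \<in> (edges (carrier G))\<^sup>*"
  using assms
proof (induction arbitrary: x)
  case one
  then show ?case by simp
next
  case (incl s)
  then have "(x, s \<otimes> x) \<in> edges (carrier G)" using S_carrier by (auto simp: edges_def)
  then show ?case by blast
next
  case (inv s)
  then have "(x, inv s \<otimes> x) \<in> edges (carrier G)"
    using S_carrier S_inv by (auto simp: edges_def)
  then show ?case by blast
next
  case (eng h1 h2)
  then have h: "h1 \<in> carrier G" "h2 \<in> carrier G" by (simp_all add: S_generate)
  then have "(x, h2 \<otimes> x) \<in> (edges (carrier G))\<^sup>*"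
    "(h2 \<otimes> x, h1 \<otimes> (h2 \<otimes> x)) \<in> (edges (carrier G))\<^sup>*" using eng by simp_all
  then have "(x, h1 \<otimes> (h2 \<otimes> x)) \<in> (edges (carrier G))\<^sup>*" by (rule rtrancl_trans)
  then show ?case using h eng.prems by (simp add: m_assoc)
qed

lemma S_connected_carrier: "S_connected (carrier G)"
proof (rule S_connectedI_center[of _ \<one>])
  fix x assume "x \<in> carrier G"
  then show "(\<one>, x) \<in> (edges (carrier G))\<^sup>*"
    using rtrancl_edges_generate[of x \<one>] by (simp add: S_generate)
qed simp

lemma S_connected_r_coset:
  assumes "S_connected A" "A \<subseteq> carrier G" "w \<in> carrier G"
  shows "S_connected (A #> w)"
  unfolding S_connected_def
proof (intro ballI)
  have step: "(x \<otimes> w, y \<otimes> w) \<in> (edges (A #> w))\<^sup>*" if "(x, y) \<in> (edges A)\<^sup>*" for x y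
    using that
  proof induction
    case (step y z)
    then obtain s where s: "s \<in> S" "z = s \<otimes> y" "y \<in> A" "z \<in> A" by (auto simp: edges_def)
    then have "z \<otimes> w = s \<otimes> (y \<otimes> w)"
      using assms S_carrier by (simp add: m_assoc subset_iff)
    moreover have "y \<otimes> w \<in> A #> w" "z \<otimes> w \<in> A #> w" using s by (auto simp: r_coset_def)
    ultimately have "(y \<otimes> w, z \<otimes> w) \<in> edges (A #> w)" using s(1) by (auto simp: edges_def)
    then show ?case using step.IH by (rule rtrancl_into_rtrancl[rotated])
  qed simp
  fix x y assume "x \<in> A #> w" "y \<in> A #> w"
  then obtain a b where "a \<in> A" "b \<in> A" "x = a \<otimes> w" "y = b \<otimes> w" by (auto simp: r_coset_def)
  then show "(x, y) \<in> (edges (A #> w))\<^sup>*" using step S_connectedD[OF assms(1)] by blast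
qed

lemma boundary_r_coset:
  assumes "A \<subseteq> carrier G" "w \<in> carrier G"
  shows "boundary (A #> w) \<subseteq> boundary A #> w"
proof
  fix x assume "x \<in> boundary (A #> w)"
  then obtain a s where a: "a \<in> A" "x = a \<otimes> w" "s \<in> S" "s \<otimes> x \<notin> A #> w"
    by (auto simp: boundary_def r_coset_def)
  then have "s \<otimes> x = (s \<otimes> a) \<otimes> w" using assms S_carrier by (simp add: m_assoc subset_iff)
  then have "s \<otimes> a \<notin> A" using a by (auto simp: r_coset_def)
  then have "a \<in> boundary A" using a by (auto simp: boundary_def)
  then show "x \<in> boundary A #> w" using a by (auto simp: r_coset_def)
qed

text \<open>A path inside \<open>A\<close> could leave \<open>C\<close> only from a point of
  \<open>boundary C\<close>. With \<open>A\<close> the whole group, a non-empty set without boundary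
  is everything.\<close>

lemma S_connected_subset:
  assumes A: "S_connected A" and x: "x \<in> A" "x \<in> C" and b: "A \<inter> boundary C = {}"
  shows "A \<subseteq> C"
proof
  fix y assume "y \<in> A"
  with A x have "(x, y) \<in> (edges A)\<^sup>*" by (simp add: S_connected_def)
  then show "y \<in> C"
  proof induction
    case (step y z)
    then show ?case using b by (auto simp: edges_def boundary_def)
  qed (rule x)
qed

lemma finite_boundary:
  assumes "almost_invariant A"
  shows "finite (boundary A)"
proof -
  have "boundary A = (\<Union>s\<in>S. {x \<in> A. s \<otimes> x \<notin> A})" by (auto simp: boundary_def)
  then show ?thesis using almost_invariantD[OF assms] S_carrier S_finite by auto
qed

lemma almost_invariantI:
  assumes A: "A \<subseteq> carrier G" and fin: "finite (boundary A)"
  shows "almost_invariant A"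
  unfolding almost_invariant_def
proof (intro conjI ballI A)
  fix k assume "k \<in> carrier G"
  then have "k \<in> generate G S" by (simp add: S_generate)
  then show "finite {x \<in> A. k \<otimes> x \<notin> A}"
  proof induction
    case one
    have "{x \<in> A. \<one> \<otimes> x \<notin> A} = {}" using A by auto
    then show ?case by (simp only: finite.emptyI)
  next
    case (incl s)
    then have "{x \<in> A. s \<otimes> x \<notin> A} \<subseteq> boundary A" by (auto simp: boundary_def)
    then show ?case using fin finite_subset by blast
  next
    case (inv s)
    then have "{x \<in> A. inv s \<otimes> x \<notin> A} \<subseteq> boundary A" using S_inv by (auto simp: boundary_def)
    then show ?case using fin finite_subset by blast
  next
    case (eng h k)
    then have hk: "h \<in> carrier G" "k \<in> carrier G" by (simp_all add: S_generate)
    let ?X = "{x \<in> carrier G. k \<otimes> x \<in> {y \<in> A. h \<otimes> y \<notin> A}}"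
    have "inj_on (\<lambda>x. k \<otimes> x) (carrier G)" using hk by (auto simp: inj_on_def)
    from finite_vimage_IntI[OF eng.IH(1) this] have "finite ?X"
      by (rule finite_subset[rotated]) auto
    moreover have "{x \<in> A. h \<otimes> k \<otimes> x \<notin> A} \<subseteq> {x \<in> A. k \<otimes> x \<notin> A} \<union> ?X"
      using A hk by (auto simp: m_assoc subset_iff)
    ultimately show ?case using eng.IH(2) finite_subset by blast
  qed
qed

text \<open>Each component of \<open>A\<close> has its boundary inside \<open>boundary A\<close>,
  and a non-empty one unless \<open>A\<close> is the whole group. So finitely many components cover
  \<open>A\<close>, and one of them is infinite.\<close>

lemma infinite_component:
  assumes A: "almost_invariant A" "infinite A"
  obtains C where "C \<subseteq> A" "infinite C" "almost_invariant C" "S_connected C"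
proof (cases "A = carrier G")
  case True
  then show ?thesis using that[of A] A S_connected_carrier by simp
next
  case False
  have AG: "A \<subseteq> carrier G" using A(1) by (rule almost_invariant_carrier)
  define comp where "comp x = {y \<in> A. (x, y) \<in> (edges A)\<^sup>*}" for x
  have conn: "S_connected (comp x)" for x
  proof (rule S_connectedI_center[of _ x])
    show "comp x \<subseteq> carrier G" using AG by (auto simp: comp_def)
    fix y assume y: "y \<in> comp x"
    then have "(x, y) \<in> (edges A)\<^sup>*" by (simp add: comp_def)
    then show "(x, y) \<in> (edges (comp x))\<^sup>*"
    proof induction
      case (step y z)
      have "y \<in> comp x" using step.hyps by (auto simp: comp_def edges_def)
      moreover have "z \<in> comp x"
        using rtrancl_into_rtrancl[OF step.hyps] step.hyps(2) by (auto simp: comp_def edges_def)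
      ultimately have "(y, z) \<in> edges (comp x)" using step.hyps(2) by (auto simp: edges_def)
      then show ?case using step.IH by (rule rtrancl_into_rtrancl[rotated])
    qed simp
  qed
  have bd: "boundary (comp x) \<subseteq> boundary A" for x
  proof
    fix y assume "y \<in> boundary (comp x)"
    then obtain s where s: "y \<in> A" "(x, y) \<in> (edges A)\<^sup>*" "s \<in> S" "s \<otimes> y \<notin> comp x"
      by (auto simp: boundary_def comp_def)
    have "s \<otimes> y \<notin> A"
    proof
      assume "s \<otimes> y \<in> A"
      then have "(y, s \<otimes> y) \<in> edges A" using s by (auto simp: edges_def)
      then have "(x, s \<otimes> y) \<in> (edges A)\<^sup>*" using s(2) by (rule rtrancl_into_rtrancl[rotated])
      then show False using s(4) \<open>s \<otimes> y \<in> A\<close> by (simp add: comp_def)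
    qed
    then show "y \<in> boundary A" using s by (auto simp: boundary_def)
  qed
  have fin: "finite (boundary A)" by (rule finite_boundary[OF A(1)])
  have "A \<subseteq> (\<Union>b\<in>boundary A. comp b)"
  proof
    fix x assume x: "x \<in> A"
    then have xc: "x \<in> comp x" by (simp add: comp_def)
    have "boundary (comp x) \<noteq> {}"
    proof
      assume "boundary (comp x) = {}"
      then have "carrier G \<subseteq> comp x"
        using S_connected_subset[OF S_connected_carrier _ xc] x AG by blast
      then show False using False AG by (auto simp: comp_def)
    qed
    then obtain b where b: "b \<in> boundary (comp x)" by blast
    then have "(x, b) \<in> (edges A)\<^sup>*" by (simp add: boundary_def comp_def)
    then have "x \<in> comp b" using rtrancl_edges_sym[OF AG] x by (simp add: comp_def)
    then show "x \<in> (\<Union>b\<in>boundary A. comp b)" using b bd by blast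
  qed
  then obtain b where "infinite (comp b)" using A(2) fin finite_subset by blast
  moreover have "comp b \<subseteq> A" by (auto simp: comp_def)
  moreover have "almost_invariant (comp b)"
    using finite_subset[OF bd fin] AG by (intro almost_invariantI) (auto simp: comp_def)
  ultimately show ?thesis using that conn by blast
qed

lemma finite_connected_superset:
  assumes "finite Q" "Q \<subseteq> carrier G"
  obtains P where "finite P" "P \<subseteq> carrier G" "S_connected P" "Q \<subseteq> P"
proof -
  have one: "\<exists>P. finite P \<and> P \<subseteq> carrier G \<and> S_connected P \<and> \<one> \<in> P \<and> x \<in> P"
    if "x \<in> carrier G" for x
  proof -
    have "(\<one>, x) \<in> (edges (carrier G))\<^sup>*"
      using S_connectedD[OF S_connected_carrier _ that] by simp
    then show ?thesis
    proof induction
      case base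
      show ?case by (rule exI[of _ "{\<one>}"]) (simp add: S_connected_def)
    next
      case (step y z)
      then obtain P where P: "finite P" "P \<subseteq> carrier G" "S_connected P" "\<one> \<in> P" "y \<in> P" by blast
      have yz: "y \<in> carrier G" "z \<in> carrier G" "(y, z) \<in> edges {y, z}"
        using step.hyps(2) by (auto simp: edges_def)
      have "S_connected {y, z}"
        by (rule S_connectedI_center[of _ y]) (use yz in auto)
      then have "S_connected (P \<union> {y, z})"
        using S_connected_Un[OF P(3) _ P(2) _ P(5), of "{y, z}"] yz by simp
      then show ?case using P yz by (intro exI[of _ "P \<union> {y, z}"]) auto
    qed
  qed
  then obtain P where P: "\<And>x. x \<in> carrier G \<Longrightarrow>
      finite (P x) \<and> P x \<subseteq> carrier G \<and> S_connected (P x) \<and> \<one> \<in> P x \<and> x \<in> P x" by metis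
  have "S_connected (\<Union>(P ` Q))" using P assms by (intro S_connected_Union[of _ \<one>]) blast
  moreover have "finite (\<Union>(P ` Q))" "\<Union>(P ` Q) \<subseteq> carrier G" "Q \<subseteq> \<Union>(P ` Q)" using P assms by blast+
  ultimately show ?thesis using that by blast
qed

text \<open>
  \<open>C - (C #> w)\<close> is a fundamental domain for the right translations by powers of \<open>w\<close>: the union and
  the intersection of all translates of \<open>C\<close> have empty boundary, because otherwise \<open>C\<close> would have
  infinitely many boundary points.
\<close>

lemma contracted_set_finite_index:
  assumes C: "almost_invariant C" "C \<noteq> {}" "C \<noteq> carrier G" and w: "w \<in> carrier G"
    and sub: "C #> w \<subset> C" and fin: "finite (C - (C #> w))"
  shows "finite_extension_of_infinite_cyclic G"
proof -
  have CG: "C \<subseteq> carrier G" using C(1) by (rule almost_invariant_carrier)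
  let ?p = "\<lambda>i::int. w [^] i"
  have p_add: "x \<otimes> ?p (i + j) = x \<otimes> ?p i \<otimes> ?p j" if "x \<in> carrier G" for x i j
    using that w by (simp add: int_pow_mult m_assoc)
  \<comment> \<open>Since \<open>w\<close> maps \<open>C\<close> into itself, an orbit that has
    entered \<open>C\<close> stays there under positive powers.\<close>
  have shift: "x \<otimes> ?p j \<in> C" if x: "x \<in> carrier G" and i: "x \<otimes> ?p i \<in> C" and "i \<le> j" for x i j
    using \<open>i \<le> j\<close>
  proof (induction j rule: int_ge_induct)
    case (step j)
    then have "x \<otimes> ?p j \<otimes> w \<in> C #> w" by (auto simp: r_coset_def)
    then show ?case using sub p_add[OF x, of j 1] w by auto
  qed (rule i)
  obtain a where a: "a \<in> C" "a \<notin> C #> w" using sub by blast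
  then have aG: "a \<in> carrier G" using CG by blast
  \<comment> \<open>\<open>a\<close> is the first point of its orbit inside \<open>C\<close>, which
    makes the powers of \<open>w\<close> distinct.\<close>
  have a': "a \<otimes> ?p i \<notin> C" if "i < 0" for i
  proof
    assume "a \<otimes> ?p i \<in> C"
    then have "a \<otimes> ?p (-1) \<in> C" using shift[OF aG, of i "-1"] that by simp
    moreover have "a \<otimes> ?p (-1) \<otimes> w = a" using aG w by (simp add: int_pow_neg m_assoc)
    ultimately show False using a(2) by (auto simp: r_coset_def)
  qed
  have inj: "i = j" if "?p i = ?p j" for i j
  proof (rule ccontr)
    assume "i \<noteq> j"
    have "?p (i - j) = \<one>" "?p (j - i) = \<one>" using that w by (simp_all add: int_pow_diff)
    then show False using a'[of "i - j"] a'[of "j - i"] a(1) aG \<open>i \<noteq> j\<close>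
      by (metis diff_less_0_iff_less linorder_neqE_linordered_idom r_one)
  qed
  have inf: "infinite ((\<lambda>i. x \<otimes> ?p i) ` I)" if "infinite I" "x \<in> carrier G" for x I
  proof -
    have "inj_on (\<lambda>i. x \<otimes> ?p i) I" using inj that w by (auto simp: inj_on_def)
    then show ?thesis using that finite_imageD by blast
  qed
  have bfin: "finite (boundary C)" by (rule finite_boundary[OF C(1)])
  have up: "\<exists>i. x \<otimes> ?p i \<in> C" if "x \<in> carrier G" for x
  proof -
    \<comment> \<open>The union of all translates of \<open>C\<close>. If \<open>x\<close> belongs
      to it and its neighbour \<open>s \<otimes> x\<close> does not, a whole upward ray of the orbit
      of \<open>x\<close> consists of boundary points of \<open>C\<close>.\<close>
    let ?U = "{x \<in> carrier G. \<exists>i. x \<otimes> ?p i \<in> C}"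
    have "boundary ?U = {}"
    proof (rule ccontr)
      assume "boundary ?U \<noteq> {}"
      then obtain x s i where x: "x \<in> carrier G" "x \<otimes> ?p i \<in> C" "s \<in> S" "s \<otimes> x \<notin> ?U"
        by (auto simp: boundary_def)
      have sG: "s \<in> carrier G" using x S_carrier by blast
      have "(\<lambda>i. x \<otimes> ?p i) ` {i..} \<subseteq> boundary C"
      proof (rule image_subsetI)
        fix j assume "j \<in> {i..}"
        then have "x \<otimes> ?p j \<in> C" using shift[OF x(1,2)] by simp
        moreover have "s \<otimes> (x \<otimes> ?p j) \<notin> C" using x sG w by (auto simp: m_assoc)
        ultimately show "x \<otimes> ?p j \<in> boundary C" using x by (auto simp: boundary_def)
      qed
      then show False using bfin inf[OF infinite_Ici x(1), of i] finite_subset by blast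
    qed
    moreover have "a \<in> ?U" using a aG by (auto intro: exI[of _ 0])
    ultimately have "carrier G \<subseteq> ?U"
      using S_connected_subset[OF S_connected_carrier aG, of ?U] by simp
    then show ?thesis using that by auto
  qed
  have down: "\<exists>i. x \<otimes> ?p i \<notin> C" if "x \<in> carrier G" for x
  proof (rule ccontr)
    \<comment> \<open>The intersection of all translates. A neighbour \<open>s \<otimes> x\<close>
      outside of it is off \<open>C\<close> at some power of \<open>w\<close>, hence at all smaller
      ones, which gives a downward ray of boundary points.\<close>
    let ?I = "{x \<in> carrier G. \<forall>i. x \<otimes> ?p i \<in> C}"
    assume "\<not> ?thesis"
    then have xI: "x \<in> ?I" using that by simp
    have "boundary ?I = {}"
    proof (rule ccontr)
      assume "boundary ?I \<noteq> {}"
      then obtain x s where x: "x \<in> carrier G" "\<And>i. x \<otimes> ?p i \<in> C" "s \<in> S" "s \<otimes> x \<notin> ?I"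
        by (auto simp: boundary_def)
      have sG: "s \<in> carrier G" using x S_carrier by blast
      then obtain i where i: "s \<otimes> x \<otimes> ?p i \<notin> C" using x by auto
      have "(\<lambda>i. x \<otimes> ?p i) ` {..i} \<subseteq> boundary C"
      proof (rule image_subsetI)
        fix j assume "j \<in> {..i}"
        then have "s \<otimes> x \<otimes> ?p j \<notin> C" using shift[of "s \<otimes> x" j i] x sG i by auto
        then have "s \<otimes> (x \<otimes> ?p j) \<notin> C" using x sG w by (simp add: m_assoc)
        then show "x \<otimes> ?p j \<in> boundary C" using x by (auto simp: boundary_def)
      qed
      then show False using bfin inf[OF infinite_Iic x(1), of i] finite_subset by blast
    qed
    then have "carrier G \<subseteq> ?I" using S_connected_subset[OF S_connected_carrier that xI] by simp
    then have "a \<in> ?I" using aG by (rule subsetD)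
    then show False using a'[of "-1"] by simp
  qed
  define D where "D = C - (C #> w)"
  have dom: "\<exists>d\<in>D. \<exists>i. x = d \<otimes> ?p i" if x: "x \<in> carrier G" for x
  proof -
    obtain i where i: "x \<otimes> ?p i \<in> C" using up[OF x] by blast
    obtain j where j: "x \<otimes> ?p j \<notin> C" using down[OF x] by blast
    have "j < i" using shift[OF x i, of j] j by (meson not_le)
    have "\<exists>k. x \<otimes> ?p k \<notin> C \<and> x \<otimes> ?p (k + 1) \<in> C"
    proof (rule ccontr)
      assume "\<not> ?thesis"
      then have nxt: "x \<otimes> ?p k \<notin> C \<Longrightarrow> x \<otimes> ?p (k + 1) \<notin> C" for k by blast
      have "x \<otimes> ?p k \<notin> C" if "j \<le> k" for k
        using that by (induction k rule: int_ge_induct) (use j nxt in auto)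
      then show False using i \<open>j < i\<close> by force
    qed
    then obtain k where k: "x \<otimes> ?p k \<notin> C" "x \<otimes> ?p (k + 1) \<in> C" by blast
    have "x \<otimes> ?p (k + 1) \<notin> C #> w"
    proof
      assume "x \<otimes> ?p (k + 1) \<in> C #> w"
      then obtain c where c: "c \<in> C" "x \<otimes> ?p k \<otimes> w = c \<otimes> w"
        using p_add[OF x, of k 1] w by (auto simp: r_coset_def)
      then have "x \<otimes> ?p k = c" using x w CG by (auto simp: subset_iff)
      then show False using c k by simp
    qed
    then have "x \<otimes> ?p (k + 1) \<in> D" using k by (simp add: D_def)
    moreover have "x = x \<otimes> ?p (k + 1) \<otimes> ?p (- (k + 1))"
      using p_add[OF x, of "k + 1" "- (k + 1)"] x by simp
    ultimately show ?thesis by blast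
  qed
  define H where "H = range ?p"
  have H: "subgroup H G"
  proof
    show "H \<subseteq> carrier G" using w by (auto simp: H_def)
    show "x \<otimes> y \<in> H" if "x \<in> H" "y \<in> H" for x y
      using that w by (auto simp: H_def simp flip: int_pow_mult)
    show "\<one> \<in> H" unfolding H_def by (rule range_eqI[of _ _ 0]) simp
    show "inv x \<in> H" if "x \<in> H" for x
      using that w by (auto simp: H_def simp flip: int_pow_neg)
  qed
  have "infinite H"
    unfolding H_def using inj by (auto simp: inj_on_def infinite_UNIV_int dest!: finite_imageD)
  moreover have "cyclic_group (G\<lparr>carrier := H\<rparr>)"
  proof -
    interpret H: group "G\<lparr>carrier := H\<rparr>" by (rule subgroup.subgroup_is_group[OF H group_axioms])
    have wH: "w \<in> H" unfolding H_def by (rule range_eqI[of _ _ 1]) (use w in simp)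
    have "w [^]\<^bsub>G\<lparr>carrier := H\<rparr>\<^esub> i = ?p i" for i :: int
      using int_pow_consistent[OF H wH] by simp
    then have "carrier (G\<lparr>carrier := H\<rparr>) = range (\<lambda>i::int. w [^]\<^bsub>G\<lparr>carrier := H\<rparr>\<^esub> i)"
      by (simp add: H_def)
    then show ?thesis unfolding H.cyclic_group using wH by auto
  qed
  moreover have "finite (rcosets H)"
  proof -
    \<comment> \<open>The domain \<open>D\<close> represents left cosets, so right cosets are
      reached by decomposing \<open>inv x\<close>.\<close>
    have "rcosets H \<subseteq> (\<lambda>d. H #> inv d) ` D"
    proof
      fix R assume "R \<in> rcosets H"
      then obtain x where x: "x \<in> carrier G" "R = H #> x" by (auto simp: RCOSETS_def)
      obtain d i where d: "d \<in> D" "inv x = d \<otimes> ?p i" using dom[of "inv x"] x by auto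
      have dG: "d \<in> carrier G" using d CG by (auto simp: D_def)
      have "x = inv (d \<otimes> ?p i)" using d x by (metis inv_inv)
      then have "x = ?p (- i) \<otimes> inv d" using dG w by (simp add: inv_mult_group int_pow_neg)
      then have "x \<in> H #> inv d" by (auto simp: r_coset_def H_def)
      then have "R = H #> inv d"
        using x repr_independence[OF _ _ H, of x "inv d"] dG by simp
      then show "R \<in> (\<lambda>d. H #> inv d) ` D" using d by blast
    qed
    then show ?thesis using fin finite_surj unfolding D_def by auto
  qed
  ultimately show ?thesis unfolding finite_extension_of_infinite_cyclic_def using H by blast
qed

end

subsection \<open>Ends of finitely generated groups with a 2-selector\<close>

locale oriented_generated_group = oriented_group G lt K + generated_group G S
  for G (structure) and lt K S
begin

text \<open>One finite threshold for all generators; \<open>near #> y\<close> is the ball that a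
  point moving past \<open>y\<close> has to avoid. Symmetry lets the same ball serve whichever of
  the two points moves.\<close>

definition near :: "'a set" where
  "near = \<Union>(K ` S) \<union> m_inv G ` \<Union>(K ` S)"

lemma near_finite: "finite near"
  using S_finite S_carrier K_finite by (auto simp: near_def)

lemma K_S_carrier: "\<Union>(K ` S) \<subseteq> carrier G"
  by (rule UN_least) (use S_carrier K_carrier in blast)

lemma near_carrier: "near \<subseteq> carrier G"
proof -
  have "m_inv G ` X \<subseteq> carrier G" if "X \<subseteq> carrier G" for X using that by auto
  then show ?thesis using K_S_carrier unfolding near_def by blast
qed

lemma near_inv: "x \<in> near \<Longrightarrow> inv x \<in> near"
  using inv_image_inv_image[OF K_S_carrier] unfolding near_def by blast

lemma K_subset_near: "s \<in> S \<Longrightarrow> K s \<subseteq> near"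
  by (auto simp: near_def)

lemma lt_path_left:
  assumes "(x, x') \<in> (edges (carrier G - (near #> y)))\<^sup>*" and y: "y \<in> carrier G"
  shows "lt x' y \<longleftrightarrow> lt x y"
  using assms(1)
proof induction
  case (step u v)
  then obtain s where s: "u \<in> carrier G" "u \<notin> near #> y" "s \<in> S" "v = s \<otimes> u"
    by (auto simp: edges_def)
  then have "u \<otimes> inv y \<notin> K s" using mem_r_coset_iff[OF near_carrier] K_subset_near y by blast
  then have "lt v y \<longleftrightarrow> lt u y" using lt_step_left s y S_carrier by blast
  then show ?case using step.IH by simp
qed simp

lemma lt_path_right:
  assumes "(y, y') \<in> (edges (carrier G - (near #> x)))\<^sup>*" and x: "x \<in> carrier G"
  shows "lt x y' \<longleftrightarrow> lt x y"
  using assms(1)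
proof induction
  case (step u v)
  then obtain s where s: "u \<in> carrier G" "u \<notin> near #> x" "s \<in> S" "v = s \<otimes> u"
    by (auto simp: edges_def)
  then have "u \<otimes> inv x \<notin> near" using mem_r_coset_iff[OF near_carrier] x by blast
  moreover have "u \<otimes> inv x = inv (x \<otimes> inv u)" using s x by (simp add: inv_mult_group)
  ultimately have "x \<otimes> inv u \<notin> near" using near_inv by metis
  then have "x \<otimes> inv u \<notin> K s" using K_subset_near s by blast
  then have "lt x v \<longleftrightarrow> lt x u" using lt_step_right s x S_carrier by blast
  then show ?case using step.IH by simp
qed simp

text \<open>\<open>c\<close> is the parking place: the pair goes from \<open>(a, b)\<close> to
  \<open>(c, b)\<close>, \<open>(c, a)\<close> and \<open>(b, a)\<close>, and its orientation
  survives each move although the points are finally swapped.\<close>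

lemma no_exchange:
  assumes G: "a \<in> carrier G" "b \<in> carrier G" "c \<in> carrier G" and "a \<noteq> b"
    and "(a, c) \<in> (edges (carrier G - (near #> b)))\<^sup>*"
    and "(b, a) \<in> (edges (carrier G - (near #> c)))\<^sup>*"
    and "(c, b) \<in> (edges (carrier G - (near #> a)))\<^sup>*"
  shows False
proof -
  have "lt a b \<longleftrightarrow> lt c b" using lt_path_left assms by blast
  also have "\<dots> \<longleftrightarrow> lt c a" using lt_path_right assms by blast
  also have "\<dots> \<longleftrightarrow> lt b a" using lt_path_left assms by blast
  finally show False using lt_swap assms by blast
qed

text \<open>Each \<open>m\<close> in the finite set \<open>near\<close> carries only finitely many
  points of \<open>C\<close> out of \<open>C\<close> or into \<open>Q\<close>. A point parked at
  \<open>d\<close> therefore does not obstruct paths through \<open>Q\<close> or outside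
  \<open>C\<close>.\<close>

lemma deep_point:
  assumes C: "almost_invariant C" "infinite C" and Q: "finite Q" "Q \<subseteq> carrier G"
  obtains d where "d \<in> C" "near #> d \<subseteq> C - Q"
proof -
  have CG: "C \<subseteq> carrier G" using C(1) by (rule almost_invariant_carrier)
  let ?bad = "\<Union>m\<in>near. {x \<in> C. m \<otimes> x \<notin> C} \<union> (\<lambda>q. inv m \<otimes> q) ` Q"
  have "finite ?bad"
    using near_finite near_carrier almost_invariantD[OF C(1)] Q(1) by auto
  then have "\<not> C \<subseteq> ?bad" using C(2) finite_subset by blast
  then obtain d where d: "d \<in> C" "d \<notin> ?bad" by blast
  have "near #> d \<subseteq> C - Q"
  proof
    fix x assume "x \<in> near #> d"
    then obtain m where m: "m \<in> near" "x = m \<otimes> d" by (auto simp: r_coset_def)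
    then have "x \<in> C" using d by blast
    moreover have "x \<notin> Q"
    proof
      assume "x \<in> Q"
      moreover have "d = inv m \<otimes> x" using m near_carrier d CG by (auto simp: subset_iff)
      ultimately show False using d m(1) by blast
    qed
    ultimately show "x \<in> C - Q" by blast
  qed
  then show ?thesis using that d by blast
qed

text \<open>
  With three ends there is a place to park one of two points while the other one moves from its end
  to the free end; three such moves exchange the two points without ever bringing them close.
\<close>

lemma no_three_ends:
  assumes "almost_invariant A" "almost_invariant B" "almost_invariant C"
    and "infinite A" "infinite B" "infinite C"
    and "A \<inter> B = {}" "A \<inter> C = {}" "B \<inter> C = {}"
  shows False
proof -
  obtain A' where A: "A' \<subseteq> A" "infinite A'" "almost_invariant A'" "S_connected A'"
    using infinite_component assms(1,4) .
  obtain B' where B: "B' \<subseteq> B" "infinite B'" "almost_invariant B'" "S_connected B'"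
    using infinite_component assms(2,5) .
  obtain C' where C: "C' \<subseteq> C" "infinite C'" "almost_invariant C'" "S_connected C'"
    using infinite_component assms(3,6) .
  note sub = A(3)[THEN almost_invariant_carrier] B(3)[THEN almost_invariant_carrier]
    C(3)[THEN almost_invariant_carrier]
  obtain p q r where pqr: "p \<in> A'" "q \<in> B'" "r \<in> C'"
    using A(2) B(2) C(2) by (metis finite.emptyI ex_in_conv)
  have "finite {p, q, r}" "{p, q, r} \<subseteq> carrier G" using pqr sub by auto
  then obtain Q where Q: "finite Q" "Q \<subseteq> carrier G" "S_connected Q" "{p, q, r} \<subseteq> Q"
    using finite_connected_superset by blast
  obtain a where a: "a \<in> A'" "near #> a \<subseteq> A' - Q" using deep_point[OF A(3,2) Q(1,2)] .
  obtain b where b: "b \<in> B'" "near #> b \<subseteq> B' - Q" using deep_point[OF B(3,2) Q(1,2)] .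
  obtain c where c: "c \<in> C'" "near #> c \<subseteq> C' - Q" using deep_point[OF C(3,2) Q(1,2)] .
  \<comment> \<open>The path runs inside \<open>X\<close> to the hub \<open>Q\<close>, through it,
    and on inside \<open>Y\<close>, while the ball around \<open>z\<close> lies in \<open>Z\<close>
    and off the hub.\<close>
  have path: "(x, y) \<in> (edges (carrier G - (near #> z)))\<^sup>*"
    if X: "S_connected X" "X \<subseteq> carrier G" "x \<in> X" "x' \<in> X" "x' \<in> Q"
      and Y: "S_connected Y" "Y \<subseteq> carrier G" "y \<in> Y" "y' \<in> Y" "y' \<in> Q"
      and z: "near #> z \<subseteq> Z - Q" and dis: "X \<inter> Z = {}" "Y \<inter> Z = {}" for X Y Z x x' y y' z
  proof -
    have "S_connected (X \<union> Q)" using S_connected_Un[OF X(1) Q(3) X(2) Q(2) X(4,5)] .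
    then have "S_connected (X \<union> Q \<union> Y)"
      using S_connected_Un[OF _ Y(1) _ Y(2) _ Y(4)] X(2) Q(2) Y(5) by simp
    then have "(x, y) \<in> (edges (X \<union> Q \<union> Y))\<^sup>*" using S_connectedD X(3) Y(3) by blast
    moreover have "X \<union> Q \<union> Y \<subseteq> carrier G - (near #> z)" using X(2) Y(2) Q(2) z dis by blast
    ultimately show ?thesis by (rule rtrancl_edges_mono[rotated])
  qed
  have dis: "A' \<inter> B' = {}" "A' \<inter> C' = {}" "B' \<inter> C' = {}" using A(1) B(1) C(1) assms(7-9) by blast+
  have pqr': "p \<in> Q" "q \<in> Q" "r \<in> Q" using Q(4) by auto
  have "(a, c) \<in> (edges (carrier G - (near #> b)))\<^sup>*"
    by (rule path[OF A(4) sub(1) a(1) pqr(1) pqr'(1) C(4) sub(3) c(1) pqr(3) pqr'(3) b(2)])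
      (use dis in blast)+
  moreover have "(b, a) \<in> (edges (carrier G - (near #> c)))\<^sup>*"
    by (rule path[OF B(4) sub(2) b(1) pqr(2) pqr'(2) A(4) sub(1) a(1) pqr(1) pqr'(1) c(2)])
      (use dis in blast)+
  moreover have "(c, b) \<in> (edges (carrier G - (near #> a)))\<^sup>*"
    by (rule path[OF C(4) sub(3) c(1) pqr(3) pqr'(3) B(4) sub(2) b(1) pqr(2) pqr'(2) a(2)])
      (use dis in blast)+
  moreover have "a \<in> carrier G" "b \<in> carrier G" "c \<in> carrier G" "a \<noteq> b"
    using a(1) b(1) c(1) sub dis by blast+
  ultimately show False using no_exchange by blast
qed

text \<open>
  If an infinite component of the complement of \<open>near\<close> were cofinite, three points in general position
  could be exchanged as before.
\<close>

lemma two_ends: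
  assumes inf: "infinite (carrier G)"
  obtains C where "almost_invariant C" "infinite C" "infinite (carrier G - C)"
proof -
  have "almost_invariant (carrier G - near)"
    using almost_invariant_compl almost_invariant_finite near_finite near_carrier by blast
  moreover have "infinite (carrier G - near)" using inf near_finite by simp
  ultimately obtain C where C: "C \<subseteq> carrier G - near" "infinite C" "almost_invariant C" "S_connected C"
    using infinite_component by blast
  have CG: "C \<subseteq> carrier G" using C by blast
  have "infinite (carrier G - C)"
  proof
    assume fin: "finite (carrier G - C)"
    \<comment> \<open>Closed under inversion, so that a quotient avoiding \<open>B\<close> lies in
      \<open>C\<close> together with its inverse.\<close>
    define B where "B = (carrier G - C) \<union> m_inv G ` (carrier G - C)"
    have B: "finite B" using fin by (simp add: B_def)
    have notB: "x \<in> C" "inv x \<in> C" if "x \<in> carrier G" "x \<notin> B" for x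
    proof -
      show "x \<in> C" using that by (simp add: B_def)
      show "inv x \<in> C"
      proof (rule ccontr)
        assume "inv x \<notin> C"
        then have "inv (inv x) \<in> B" using that(1) unfolding B_def by blast
        then show False using that by simp
      qed
    qed
    \<comment> \<open>\<open>C #> z\<close> is connected and disjoint from the ball
      \<open>near #> z\<close>, so its points are joined out of reach of \<open>z\<close>.\<close>
    have path: "(x, y) \<in> (edges (carrier G - (near #> z)))\<^sup>*"
      if "x \<in> carrier G" "y \<in> carrier G" "z \<in> carrier G" "x \<otimes> inv z \<in> C" "y \<otimes> inv z \<in> C" for x y z
    proof -
      have "x \<in> C #> z" "y \<in> C #> z" using that mem_r_coset_iff[OF CG] by simp_all
      then have "(x, y) \<in> (edges (C #> z))\<^sup>*"
        using S_connectedD[OF S_connected_r_coset[OF C(4) CG that(3)]] by simp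
      moreover have "C #> z \<subseteq> carrier G - (near #> z)"
      proof
        fix u assume u: "u \<in> C #> z"
        then have uG: "u \<in> carrier G" using r_coset_subset_G[OF CG that(3)] by blast
        then have "u \<otimes> inv z \<in> C" using u mem_r_coset_iff[OF CG uG that(3)] by simp
        then show "u \<in> carrier G - (near #> z)"
          using C(1) mem_r_coset_iff[OF near_carrier uG that(3)] uG by blast
      qed
      ultimately show ?thesis by (rule rtrancl_edges_mono[rotated])
    qed
    \<comment> \<open>\<open>b\<close> and \<open>c\<close> avoid finite sets so that the quotients
      of any two of \<open>\<one>\<close>, \<open>b\<close>, \<open>c\<close> lie in
      \<open>C\<close>, in both orders.\<close>
    have "\<not> carrier G \<subseteq> insert \<one> B" using inf B finite_subset by blast
    then obtain b where b: "b \<in> carrier G" "b \<notin> B" "b \<noteq> \<one>" by blast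
    have "\<not> carrier G \<subseteq> B \<union> (B #> b)"
      using inf B finite_subset[of "carrier G" "B \<union> (B #> b)"]
      by (auto simp: r_coset_def)
    then obtain c where c: "c \<in> carrier G" "c \<notin> B" "c \<notin> B #> b" by blast
    have "B \<subseteq> carrier G" by (auto simp: B_def)
    then have cb: "c \<otimes> inv b \<notin> B" using c mem_r_coset_iff b by blast
    have "c \<otimes> inv b \<in> C" "inv (c \<otimes> inv b) \<in> C" using notB[OF _ cb] b c by simp_all
    then have "c \<otimes> inv b \<in> C" "b \<otimes> inv c \<in> C" using b c by (simp_all add: inv_mult_group)
    moreover note notB[OF b(1,2)] notB[OF c(1,2)]
    ultimately show False
      using no_exchange[of \<one> b c] path[of \<one> c b] path[of b \<one> c] path[of c b \<one>] b c by simp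
  qed
  then show ?thesis using that C by blast
qed

text \<open>
  \<open>P\<close> is a finite wall separating the ends \<open>C\<close> and \<open>D\<close>, and \<open>w\<close> a translation which preserves the ends
  and moves the wall off itself; by connectedness \<open>D \<union> P\<close> lies on one side of the moved wall.
\<close>

lemma contracting_translation:
  assumes C: "almost_invariant C" and D: "almost_invariant D" "S_connected D" "infinite D"
    and disj: "C \<inter> D = {}" and rest: "finite (carrier G - (C \<union> D))"
    and P: "S_connected P" "P \<subseteq> carrier G" "carrier G - (C \<union> D) \<subseteq> P"
    and bd: "boundary C \<subseteq> P" "boundary D \<subseteq> P" "boundary C \<noteq> {}" "boundary D \<noteq> {}"
    and w: "w \<in> carrier G" "(P #> w) \<inter> P = {}" "P #> w \<subseteq> C"
    and fin: "finite (D \<inter> (C #> w))" "finite (C \<inter> (D #> w))"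
  shows "finite_extension_of_infinite_cyclic G"
proof -
  have CG: "C \<subseteq> carrier G" and DG: "D \<subseteq> carrier G"
    using C D(1) by (simp_all add: almost_invariant_carrier)
  obtain c where c: "c \<in> boundary C" using bd by blast
  then have cC: "c \<in> C" "c \<in> P" using bd by (auto simp: boundary_def)
  obtain d where d: "d \<in> boundary D" using bd by blast
  then have dD: "d \<in> D" "d \<in> P" using bd by (auto simp: boundary_def)
  have conn: "S_connected (D \<union> P)" by (rule S_connected_Un[OF D(2) P(1) DG P(2) dD])
  have dis: "(D \<union> P) \<inter> (P #> w) = {}" using disj w by blast
  have bdw: "(D \<union> P) \<inter> boundary (X #> w) = {}" if "X \<subseteq> carrier G" "boundary X \<subseteq> P" for X
  proof -
    have "boundary (X #> w) \<subseteq> P #> w"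
      using boundary_r_coset[OF that(1) w(1)] that(2) by (auto simp: r_coset_def)
    then show ?thesis using dis by blast
  qed
  have dG: "d \<in> carrier G" using dD DG by blast
  have iw: "inv w \<in> carrier G" using w(1) by simp
  have "d \<otimes> inv w \<notin> P" using dis dD mem_r_coset_iff[OF P(2) dG w(1)] by blast
  then have "d \<otimes> inv w \<in> C \<or> d \<otimes> inv w \<in> D" using P(3) m_closed[OF dG iw] by blast
  then have dw: "d \<in> C #> w \<or> d \<in> D #> w"
    using mem_r_coset_iff[OF CG dG w(1)] mem_r_coset_iff[OF DG dG w(1)] by blast
  \<comment> \<open>Otherwise connectedness puts the infinite end \<open>D\<close> into
    \<open>C #> w\<close>, which meets it in a finite set only.\<close>
  have "d \<notin> C #> w"
  proof
    assume "d \<in> C #> w"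
    then have "D \<union> P \<subseteq> C #> w" using S_connected_subset[OF conn _ _ bdw[OF CG bd(1)]] dD by blast
    then have "D = D \<inter> (C #> w)" by blast
    then show False using fin D(3) by simp
  qed
  then have "D \<union> P \<subseteq> D #> w"
    using S_connected_subset[OF conn _ _ bdw[OF DG bd(2)]] dD dw by blast
  then have sub: "D \<subseteq> D #> w" and cw: "c \<in> D #> w" using cC by blast+
  have mem: "x \<in> D #> inv w \<longleftrightarrow> x \<otimes> w \<in> D" "x \<otimes> w \<in> D #> w \<longleftrightarrow> x \<in> D" if "x \<in> carrier G" for x
    using that mem_r_coset_iff[OF DG that iw] mem_r_coset_iff[OF DG _ w(1), of "x \<otimes> w"] w(1)
    by (simp_all add: m_assoc)
  \<comment> \<open>\<open>D\<close> grows under \<open>w\<close>, so the contraction is the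
    translation by \<open>inv w\<close>.\<close>
  have subw: "D #> inv w \<subseteq> D"
  proof
    fix x assume x: "x \<in> D #> inv w"
    then have "x \<in> carrier G" using r_coset_subset_G[OF DG iw] by blast
    then show "x \<in> D" using x mem sub by blast
  qed
  \<comment> \<open>The inclusion is strict because the wall point \<open>c\<close> of
    \<open>C\<close> lies in \<open>D #> w\<close> but not in \<open>D\<close>.\<close>
  moreover have "D #> inv w \<noteq> D"
  proof
    assume eq: "D #> inv w = D"
    obtain e where e: "e \<in> D" "c = e \<otimes> w" using cw by (auto simp: r_coset_def)
    then have "e \<otimes> w \<in> D" using mem(1)[of e] DG eq by blast
    then show False using e cC disj by blast
  qed
  ultimately have psub: "D #> inv w \<subset> D" by blast
  have "D - (D #> inv w) \<subseteq> ((D #> w) - D) #> inv w"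
  proof
    fix x assume x: "x \<in> D - (D #> inv w)"
    then have xG: "x \<in> carrier G" using DG by blast
    then have "x \<otimes> w \<in> (D #> w) - D" using x mem by blast
    moreover have "x = x \<otimes> w \<otimes> inv w" using xG w(1) by (simp add: m_assoc)
    ultimately show "x \<in> ((D #> w) - D) #> inv w" unfolding r_coset_def by blast
  qed
  moreover have "finite (((D #> w) - D) #> inv w)"
  proof -
    have DwG: "D #> w \<subseteq> carrier G" by (rule r_coset_subset_G[OF DG w(1)])
    then have "(D #> w) - D \<subseteq> (C \<inter> (D #> w)) \<union> (carrier G - (C \<union> D))" by blast
    then have "finite ((D #> w) - D)" using fin rest finite_subset by blast
    moreover have "(D #> w) - D \<subseteq> carrier G" using DwG by blast
    ultimately show ?thesis using finite_r_coset_iff iw by blast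
  qed
  ultimately have "finite (D - (D #> inv w))" using finite_subset by blast
  moreover have "D \<noteq> {}" "D \<noteq> carrier G" using dD cC disj CG by blast+
  ultimately show ?thesis using contracted_set_finite_index[OF D(1) _ _ iw psub] by blast
qed

text \<open>Translating by \<open>inv z\<close> replaces two translations by their quotient; it is
  used to show that two translations exchanging the ends differ by one that preserves them.\<close>

lemma finite_r_coset_Int:
  assumes "A \<subseteq> carrier G" "B \<subseteq> carrier G" "y \<in> carrier G" "z \<in> carrier G"
    and "finite ((A #> z) \<inter> (B #> y))"
  shows "finite (A \<inter> (B #> (y \<otimes> inv z)))"
proof -
  have "A \<inter> (B #> (y \<otimes> inv z)) \<subseteq> (\<lambda>x. x \<otimes> inv z) ` ((A #> z) \<inter> (B #> y))"
  proof
    fix x assume "x \<in> A \<inter> (B #> (y \<otimes> inv z))"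
    then obtain b where b: "x \<in> A" "b \<in> B" "x = b \<otimes> (y \<otimes> inv z)" by (auto simp: r_coset_def)
    then have G: "x \<in> carrier G" "b \<in> carrier G" using assms by auto
    have "x \<otimes> z = b \<otimes> y" "x = x \<otimes> z \<otimes> inv z" using b G assms by (simp_all add: m_assoc)
    moreover have "x \<otimes> z \<in> A #> z" "b \<otimes> y \<in> B #> y" using b by (auto simp: r_coset_def)
    ultimately show "x \<in> (\<lambda>x. x \<otimes> inv z) ` ((A #> z) \<inter> (B #> y))"
      by (intro image_eqI[of _ _ "x \<otimes> z"]) auto
  qed
  then show ?thesis using assms(5) finite_surj by blast
qed

text \<open>Right translations permute the two ends up to finite sets, so infinitely many of them
  preserve both, and only finitely many fail to move a finite wall off itself.\<close>

lemma finite_extension: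
  assumes inf: "infinite (carrier G)"
  shows "finite_extension_of_infinite_cyclic G"
proof -
  obtain A where A: "almost_invariant A" "infinite A" "infinite (carrier G - A)"
    using two_ends[OF inf] .
  obtain C where C: "C \<subseteq> A" "infinite C" "almost_invariant C" "S_connected C"
    using infinite_component[OF A(1,2)] .
  obtain D where D: "D \<subseteq> carrier G - A" "infinite D" "almost_invariant D" "S_connected D"
    using infinite_component[OF almost_invariant_compl[OF A(1)] A(3)] .
  have CG: "C \<subseteq> carrier G" and DG: "D \<subseteq> carrier G"
    using C D by (simp_all add: almost_invariant_carrier)
  have disj: "C \<inter> D = {}" using C D by blast
  define E where "E = carrier G - (C \<union> D)"
  have E: "finite E"
  proof (rule ccontr)
    assume "infinite E"
    moreover have "E = carrier G - C - D" by (auto simp: E_def)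
    then have "almost_invariant E"
      using almost_invariant_Diff[OF almost_invariant_compl[OF C(3)] D(3)] by simp
    ultimately show False using no_three_ends[OF C(3) D(3) _ C(2) D(2)] disj E_def by blast
  qed
  have bC: "boundary C \<noteq> {}" "boundary D \<noteq> {}"
  proof -
    have "X = carrier G" if X: "X \<subseteq> carrier G" "infinite X" "boundary X = {}" for X
    proof -
      obtain x where x: "x \<in> X" using X(2) by (metis finite.emptyI ex_in_conv)
      then have "carrier G \<subseteq> X"
        using S_connected_subset[OF S_connected_carrier _ x] X by blast
      then show ?thesis using X(1) by blast
    qed
    moreover have "C \<noteq> carrier G" "D \<noteq> carrier G"
      using C(2) D(2) CG DG disj by (metis Int_absorb2 Int_commute finite.emptyI)+
    ultimately show "boundary C \<noteq> {}" "boundary D \<noteq> {}"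
      using CG DG C(2) D(2) by metis+
  qed
  have bdG: "finite (E \<union> boundary C \<union> boundary D)" "E \<union> boundary C \<union> boundary D \<subseteq> carrier G"
    using E finite_boundary C(3) D(3) CG DG by (auto simp: E_def boundary_def)
  obtain P where P: "finite P" "P \<subseteq> carrier G" "S_connected P" "E \<union> boundary C \<union> boundary D \<subseteq> P"
    using finite_connected_superset[OF bdG] .
  have side: "finite (C \<inter> (C #> y)) \<and> finite (D \<inter> (D #> y)) \<or>
      finite (D \<inter> (C #> y)) \<and> finite (C \<inter> (D #> y))" if y: "y \<in> carrier G" for y
  proof -
    have aC: "almost_invariant (C #> y)" and aD: "almost_invariant (D #> y)"
      using almost_invariant_r_coset C(3) D(3) y by simp_all
    have iC: "infinite (C #> y)" and iD: "infinite (D #> y)"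
      using finite_r_coset_iff CG DG C(2) D(2) y by simp_all
    have dy: "(C #> y) \<inter> (D #> y) = {}"
    proof -
      have False if "x \<in> C #> y" "x \<in> D #> y" for x
      proof -
        have "x \<in> carrier G" using that r_coset_subset_G[OF CG y] by blast
        then show False using that mem_r_coset_iff[OF CG _ y] mem_r_coset_iff[OF DG _ y] disj by blast
      qed
      then show ?thesis by blast
    qed
    note ai = almost_invariant_Int
    \<comment> \<open>An end split into two infinite pieces, together with an end disjoint from it,
      would give three ends. Here \<open>C #> y\<close> is split by \<open>C\<close> and
      \<open>D\<close>, with \<open>D #> y\<close> as the third; the next cases split
      \<open>D\<close>, \<open>C\<close> and \<open>D #> y\<close>.\<close>
    have 1: "finite (C \<inter> (C #> y))" if "infinite (D \<inter> (C #> y))"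
      using no_three_ends[OF ai[OF D(3) aC] ai[OF C(3) aC] aD that _ iD] disj dy by blast
    have 2: "finite (D \<inter> (D #> y))" if "infinite (D \<inter> (C #> y))"
      using no_three_ends[OF ai[OF D(3) aC] ai[OF D(3) aD] C(3) that _ C(2)] disj dy by blast
    have 3: "finite (C \<inter> (C #> y))" if "infinite (C \<inter> (D #> y))"
      using no_three_ends[OF ai[OF C(3) aD] ai[OF C(3) aC] D(3) that _ D(2)] disj dy by blast
    have 4: "finite (D \<inter> (D #> y))" if "infinite (C \<inter> (D #> y))"
      using no_three_ends[OF ai[OF C(3) aD] ai[OF D(3) aD] aC that _ iC] disj dy by blast
    show ?thesis using 1 2 3 4 by blast
  qed
  define N where "N = {w \<in> carrier G. finite (D \<inter> (C #> w)) \<and> finite (C \<inter> (D #> w))}"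
  have N: "infinite N"
  proof
    assume fin: "finite N"
    then have "\<not> carrier G \<subseteq> N" using inf finite_subset by blast
    then obtain z where z: "z \<in> carrier G" "z \<notin> N" by blast
    \<comment> \<open>Outside \<open>N\<close> the ends are exchanged up to finite sets, and the
      quotient of two exchanges lies in \<open>N\<close>. So \<open>N\<close> and one translate of
      it would cover the infinite group.\<close>
    have "carrier G \<subseteq> N \<union> (N #> z)"
    proof
      fix y assume y: "y \<in> carrier G"
      have "y \<otimes> inv z \<in> N" if "y \<notin> N"
      proof -
        have fy: "finite (C \<inter> (C #> y))" "finite (D \<inter> (D #> y))"
          using side[OF y] that y by (auto simp: N_def)
        have fz: "finite (C \<inter> (C #> z))" "finite (D \<inter> (D #> z))"
          using side[OF z(1)] z by (auto simp: N_def)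
        have "(D #> z) \<inter> (C #> y) \<subseteq> (D \<inter> (D #> z)) \<union> (C \<inter> (C #> y)) \<union> E"
          "(C #> z) \<inter> (D #> y) \<subseteq> (C \<inter> (C #> z)) \<union> (D \<inter> (D #> y)) \<union> E"
          using r_coset_subset_G[OF CG y] r_coset_subset_G[OF DG y] by (auto simp: E_def)
        then have "finite ((D #> z) \<inter> (C #> y))" "finite ((C #> z) \<inter> (D #> y))"
          using fy fz E by (meson finite_UnI finite_subset)+
        then show ?thesis
          using finite_r_coset_Int[OF DG CG y z(1)] finite_r_coset_Int[OF CG DG y z(1)] y z(1)
          by (simp add: N_def)
      qed
      moreover have "N \<subseteq> carrier G" by (auto simp: N_def)
      ultimately show "y \<in> N \<union> (N #> z)" using mem_r_coset_iff[of N y z] y z(1) by blast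
    qed
    moreover have "finite (N #> z)" using fin by (simp add: r_coset_def)
    ultimately show False using inf fin finite_subset by blast
  qed
  \<comment> \<open>These quotients are exactly the translations for which the wall \<open>P\<close>
    meets its translate.\<close>
  have "finite ((\<lambda>(p, q). inv p \<otimes> q) ` (P \<times> P))" using P(1) by simp
  then have "\<not> N \<subseteq> (\<lambda>(p, q). inv p \<otimes> q) ` (P \<times> P)" using N finite_subset by blast
  then obtain w where w: "w \<in> N" "w \<notin> (\<lambda>(p, q). inv p \<otimes> q) ` (P \<times> P)" by blast
  then have wG: "w \<in> carrier G" by (simp add: N_def)
  have Pw: "(P #> w) \<inter> P = {}"
  proof -
    have False if p: "p \<in> P" "p \<otimes> w \<in> P" for p
    proof -
      have "w = inv p \<otimes> (p \<otimes> w)" using p P(2) wG by (simp add: subset_iff)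
      then show False using w(2) p by force
    qed
    then show ?thesis by (auto simp: r_coset_def)
  qed
  have PwG: "P #> w \<subseteq> carrier G" by (rule r_coset_subset_G[OF P(2) wG])
  obtain c where "c \<in> boundary C" using bC by blast
  then have cw: "c \<otimes> w \<in> P #> w" using P(4) by (auto simp: r_coset_def)
  then have "c \<otimes> w \<in> C \<or> c \<otimes> w \<in> D" using PwG Pw P(4) by (auto simp: E_def)
  \<comment> \<open>The moved wall is connected and avoids \<open>P\<close>, which contains both
    boundaries, so it stays in the end where one of its points lies. The two cases are symmetric in
    \<open>C\<close> and \<open>D\<close>.\<close>
  then have "P #> w \<subseteq> C \<or> P #> w \<subseteq> D"
    using S_connected_subset[OF S_connected_r_coset[OF P(3,2) wG] cw] Pw P(4) by blast
  moreover have "finite (D \<inter> (C #> w))" "finite (C \<inter> (D #> w))" using w by (simp_all add: N_def)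
  moreover have "boundary C \<subseteq> P" "boundary D \<subseteq> P" "E \<subseteq> P" using P(4) by blast+
  moreover have "D \<inter> C = {}" "carrier G - (C \<union> D) = E" "carrier G - (D \<union> C) = E"
    using disj by (auto simp: E_def)
  ultimately show ?thesis
    using contracting_translation[OF C(3) D(3,4,2) disj _ P(3,2) _ _ _ bC wG Pw]
      contracting_translation[OF D(3) C(3,4,2) _ _ P(3,2) _ _ _ bC(2,1) wG Pw] E by metis
qed

end

text \<open>A finite set generating an infinite subgroup becomes, with its finite thresholds, a
  finite generating set of the whole group; so failure of local finiteness leads to the study of
  ends.\<close>

lemma (in group) two_selector_structure:
  assumes "admits_2_selector G"
  shows "finite_extension_of_infinite_cyclic G \<or> countable (carrier G) \<and> locally_finite_group G"
proof -
  obtain f where "selector (carrier G) (finitary_coarse G) (two_subsets (carrier G)) f"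
    using assms by (auto simp: admits_2_selector_def)
  then obtain lt K where "oriented_group G lt K" using two_selector_oriented by blast
  then interpret oriented_group G lt K .
  have "finite_extension_of_infinite_cyclic G" if nlf: "\<not> locally_finite_group G"
  proof -
    obtain S where S: "S \<subseteq> carrier G" "finite S" "infinite (generate G S)"
      using nlf by (auto simp: locally_finite_group_def)
    define T where "T = S \<union> \<Union>(K ` S)"
    have T: "T \<subseteq> carrier G" "finite T" "generate G T = carrier G"
      using S K_carrier K_finite generate_K_eq_carrier unfolding T_def by blast+
    have T': "T \<union> m_inv G ` T \<subseteq> carrier G" using T by auto
    have "generate G (T \<union> m_inv G ` T) = carrier G"
      using mono_generate[of T "T \<union> m_inv G ` T"] T(3) generate_incl[OF T'] by blast
    then interpret oriented_generated_group G lt K "T \<union> m_inv G ` T"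
      using T T' by unfold_locales (auto simp: subset_iff)
    have "infinite (carrier G)" using S(3) generate_incl[OF S(1)] finite_subset by blast
    then show ?thesis by (rule finite_extension)
  qed
  then show ?thesis using countable_carrier by blast
qed

subsection \<open>Construction of finitary selectors\<close>

context group
begin

lemma finitary_selectorI:
  assumes mem: "\<And>A. A \<subseteq> carrier G \<Longrightarrow> finite A \<Longrightarrow> A \<noteq> {} \<Longrightarrow> f A \<in> A"
    and close: "\<And>F. finite F \<Longrightarrow> F \<subseteq> carrier G \<Longrightarrow> \<exists>K. finite K \<and> K \<subseteq> carrier G \<and>
      (\<forall>A B. A \<subseteq> carrier G \<longrightarrow> finite A \<longrightarrow> A \<noteq> {} \<longrightarrow> B \<subseteq> carrier G \<longrightarrow> finite B \<longrightarrow> B \<noteq> {} \<longrightarrow>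
        A \<subseteq> F <#> B \<longrightarrow> B \<subseteq> F <#> A \<longrightarrow> f B \<in> K #> f A)"
  shows "admits_finitary_selector G"
proof -
  let ?\<F> = "{A. A \<subseteq> carrier G \<and> finite A \<and> A \<noteq> {}}"
  have "?\<F> \<subseteq> nonempty_subsets (carrier G)" by (auto simp: nonempty_subsets_def)
  then have "selector (carrier G) (finitary_coarse G) ?\<F> f"
    unfolding selector_iff[OF \<open>?\<F> \<subseteq> _\<close>]
  proof (intro conjI ballI allI impI)
    fix F assume "finite F" "F \<subseteq> carrier G"
    from close[OF this] show "\<exists>K. finite K \<and> K \<subseteq> carrier G \<and>
        (\<forall>A\<in>?\<F>. \<forall>B\<in>?\<F>. A \<subseteq> F <#> B \<longrightarrow> B \<subseteq> F <#> A \<longrightarrow> f B \<in> K #> f A)" by (simp add: imp_conjL)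
  qed (use mem in simp)
  then show ?thesis by (auto simp: admits_finitary_selector_def)
qed

lemma finitary_imp_2_selector:
  assumes "admits_finitary_selector G"
  shows "admits_2_selector G"
proof -
  let ?\<F> = "{A. A \<subseteq> carrier G \<and> finite A \<and> A \<noteq> {}}" and ?T = "two_subsets (carrier G)"
  obtain f where f: "selector (carrier G) (finitary_coarse G) ?\<F> f"
    using assms by (auto simp: admits_finitary_selector_def)
  have T: "?T \<subseteq> ?\<F>" by (auto simp: two_subsets_def intro: card_ge_0_finite)
  have \<F>: "?\<F> \<subseteq> nonempty_subsets (carrier G)" by (auto simp: nonempty_subsets_def)
  have mem: "\<And>A. A \<in> ?\<F> \<Longrightarrow> f A \<in> A"
    and close: "\<And>F. \<lbrakk>finite F; F \<subseteq> carrier G\<rbrakk> \<Longrightarrow> \<exists>K. finite K \<and> K \<subseteq> carrier G \<and>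
        (\<forall>A\<in>?\<F>. \<forall>B\<in>?\<F>. A \<subseteq> F <#> B \<longrightarrow> B \<subseteq> F <#> A \<longrightarrow> f B \<in> K #> f A)"
    using f[unfolded selector_iff[OF \<F>]] by simp_all
  have "selector (carrier G) (finitary_coarse G) ?T f"
    unfolding selector_iff[OF subset_trans[OF T \<F>]]
  proof (intro conjI ballI allI impI)
    show "f A \<in> A" if "A \<in> ?T" for A using mem[OF subsetD[OF T that]] .
    fix F assume "finite F" "F \<subseteq> carrier G"
    from close[OF this] obtain K where K: "finite K" "K \<subseteq> carrier G"
      "\<forall>A\<in>?\<F>. \<forall>B\<in>?\<F>. A \<subseteq> F <#> B \<longrightarrow> B \<subseteq> F <#> A \<longrightarrow> f B \<in> K #> f A" by (elim exE conjE)
    have "\<forall>A\<in>?T. \<forall>B\<in>?T. A \<subseteq> F <#> B \<longrightarrow> B \<subseteq> F <#> A \<longrightarrow> f B \<in> K #> f A"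
      using K(3) subsetD[OF T] by simp
    with K(1,2) show "\<exists>K. finite K \<and> K \<subseteq> carrier G \<and>
        (\<forall>A\<in>?T. \<forall>B\<in>?T. A \<subseteq> F <#> B \<longrightarrow> B \<subseteq> F <#> A \<longrightarrow> f B \<in> K #> f A)"
      by (intro exI[of _ K] conjI)
  qed
  then show ?thesis by (auto simp: admits_2_selector_def)
qed

lemma mem_set_multE:
  assumes "x \<in> F <#> B" obtains u b where "u \<in> F" "b \<in> B" "x = u \<otimes> b"
  using assms by (auto simp: set_mult_def)

text \<open>The exponent \<open>\<phi>\<close> is the coarse projection to the integers: finite sets
  of steps change it boundedly, and points with nearby exponents are close because there are
  finitely many representatives. Minimisers of \<open>\<phi>\<close> on close sets are then
  close.\<close>

lemma infinite_cyclic_selector: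
  assumes "finite_extension_of_infinite_cyclic G"
  shows "admits_finitary_selector G"
proof -
  obtain H where H: "subgroup H G" "infinite H" "cyclic_group (G\<lparr>carrier := H\<rparr>)" "finite (rcosets H)"
    using assms by (auto simp: finite_extension_of_infinite_cyclic_def)
  have HG: "H \<subseteq> carrier G" using H(1) by (rule subgroup.subset)
  interpret H: group "G\<lparr>carrier := H\<rparr>" by (rule subgroup.subgroup_is_group[OF H(1) group_axioms])
  obtain a where "a \<in> H" "H = range (\<lambda>n::int. a [^]\<^bsub>G\<lparr>carrier := H\<rparr>\<^esub> n)"
    using H(3) unfolding H.cyclic_group by auto
  then have a: "a \<in> H" "a \<in> carrier G" "H = range (\<lambda>n::int. a [^] n)"
    using int_pow_consistent[OF H(1) \<open>a \<in> H\<close>] HG by auto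
  have inj: "inj (\<lambda>n::int. a [^] n)"
  proof -
    have "ord a = 0"
      using infinite_cyclic_subgroup_order[OF a(2)] carrier_subgroup_generated_by_singleton[OF a(2)]
        a(3) H(2) by simp
    then show ?thesis using int_pow_eq[OF a(2)] by (auto simp: inj_on_def)
  qed
  have "\<forall>R\<in>rcosets H. \<exists>r\<in>carrier G. R = H #> r" by (auto simp: RCOSETS_def)
  then obtain rep where rep: "\<And>R. R \<in> rcosets H \<Longrightarrow> rep R \<in> carrier G \<and> R = H #> rep R" by metis
  \<comment> \<open>Inverses of right coset representatives represent left cosets. This puts the
    power of \<open>a\<close> on the right, where it cancels when \<open>u \<otimes> x\<close> is
    compared with \<open>x\<close>.\<close>
  define T where "T = (\<lambda>R. inv (rep R)) ` (rcosets H)"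
  have T: "finite T" "T \<subseteq> carrier G" using H(4) rep by (auto simp: T_def)
  have "\<exists>n::int. \<exists>t\<in>T. x = t \<otimes> a [^] n" if x: "x \<in> carrier G" for x
  proof -
    have R: "H #> inv x \<in> rcosets H" using x HG by (intro rcosetsI) auto
    have "inv x \<in> H #> inv x" using rcos_self[OF _ H(1), of "inv x"] x by simp
    then have "inv x \<in> H #> rep (H #> inv x)" using rep[OF R] by simp
    then obtain n :: int where "inv x = a [^] n \<otimes> rep (H #> inv x)"
      using a(3) by (auto simp: r_coset_def)
    then have "inv (inv x) = inv (a [^] n \<otimes> rep (H #> inv x))" by simp
    then have "x = inv (rep (H #> inv x)) \<otimes> a [^] (- n)"
      using x rep[OF R] a(2) by (simp add: inv_mult_group int_pow_neg)
    then show ?thesis using R unfolding T_def by blast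
  qed
  then obtain \<phi> :: "'a \<Rightarrow> int" and \<tau> where
      \<phi>: "\<And>x. x \<in> carrier G \<Longrightarrow> \<tau> x \<in> T \<and> x = \<tau> x \<otimes> a [^] \<phi> x" by metis
  have bound: "\<exists>C. \<forall>u\<in>F. \<forall>x\<in>carrier G. \<bar>\<phi> (u \<otimes> x) - \<phi> x\<bar> \<le> C"
    if F: "finite F" "F \<subseteq> carrier G" for F
  proof -
    let ?W = "(\<lambda>(t, u, t'). inv t \<otimes> u \<otimes> t') ` (T \<times> F \<times> T)"
    \<comment> \<open>Finite because \<open>a\<close> has infinite order, so each of the finitely
      many elements of \<open>?W\<close> is at most one power of \<open>a\<close>.\<close>
    define D where "D = (\<lambda>n::int. a [^] n) -` ?W"
    have D: "finite D" unfolding D_def using T F inj by (intro finite_vimageI) auto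
    have "\<bar>\<phi> (u \<otimes> x) - \<phi> x\<bar> \<le> Max (insert 0 (abs ` D))"
      if u: "u \<in> F" and x: "x \<in> carrier G" for u x
    proof -
      have uG: "u \<in> carrier G" using u F by blast
      have t: "\<tau> x \<in> T" "\<tau> (u \<otimes> x) \<in> T" using \<phi> uG x by simp_all
      then have tG: "\<tau> x \<in> carrier G" "\<tau> (u \<otimes> x) \<in> carrier G" using T by auto
      have "\<tau> (u \<otimes> x) \<otimes> a [^] \<phi> (u \<otimes> x) = u \<otimes> (\<tau> x \<otimes> a [^] \<phi> x)"
        using \<phi>[of x] \<phi>[of "u \<otimes> x"] uG x by simp
      then have "inv (\<tau> (u \<otimes> x)) \<otimes> (\<tau> (u \<otimes> x) \<otimes> a [^] \<phi> (u \<otimes> x)) \<otimes> inv (a [^] \<phi> x) =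
          inv (\<tau> (u \<otimes> x)) \<otimes> (u \<otimes> (\<tau> x \<otimes> a [^] \<phi> x)) \<otimes> inv (a [^] \<phi> x)" by simp
      then have "a [^] \<phi> (u \<otimes> x) \<otimes> inv (a [^] \<phi> x) = inv (\<tau> (u \<otimes> x)) \<otimes> u \<otimes> \<tau> x"
        using tG uG a(2) by (simp add: m_assoc)
      then have "a [^] (\<phi> (u \<otimes> x) - \<phi> x) = inv (\<tau> (u \<otimes> x)) \<otimes> u \<otimes> \<tau> x"
        using a(2) by (simp add: int_pow_diff)
      then have "\<phi> (u \<otimes> x) - \<phi> x \<in> D" using t u unfolding D_def by force
      then show ?thesis using D by (intro Max_ge) auto
    qed
    then show ?thesis by blast
  qed
  show ?thesis
  proof (rule finitary_selectorI)
    fix F assume F: "finite F" "F \<subseteq> carrier G"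
    obtain C where C: "\<And>u x. u \<in> F \<Longrightarrow> x \<in> carrier G \<Longrightarrow> \<bar>\<phi> (u \<otimes> x) - \<phi> x\<bar> \<le> C"
      using bound[OF F] by blast
    define K where "K = (\<lambda>(t, n, t'). t \<otimes> a [^] n \<otimes> inv t') ` (T \<times> {-C..C} \<times> T)"
    have K: "finite K" "K \<subseteq> carrier G" using T a(2) by (auto simp: K_def)
    have near: "y \<in> K #> x" if x: "x \<in> carrier G" and y: "y \<in> carrier G" and d: "\<bar>\<phi> y - \<phi> x\<bar> \<le> C" for x y
    proof -
      have tG: "\<tau> x \<in> carrier G" "\<tau> y \<in> carrier G" using \<phi> x y T by blast+
      have "y \<otimes> inv x = \<tau> y \<otimes> a [^] \<phi> y \<otimes> inv (\<tau> x \<otimes> a [^] \<phi> x)" using \<phi> x y by simp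
      also have "\<dots> = \<tau> y \<otimes> a [^] (\<phi> y - \<phi> x) \<otimes> inv (\<tau> x)"
        using tG a(2) by (simp add: inv_mult_group int_pow_diff m_assoc)
      also have "\<dots> \<in> K"
        unfolding K_def by (rule image_eqI[of _ _ "(\<tau> y, \<phi> y - \<phi> x, \<tau> x)"]) (use \<phi> x y d in auto)
      finally show ?thesis using mem_r_coset_iff[OF K(2) y x] by simp
    qed
    \<comment> \<open>The minimiser on \<open>A\<close> is one step away from a point of
      \<open>B\<close>, whose exponent bounds the minimum over \<open>B\<close>.\<close>
    have le: "\<phi> (arg_min_on \<phi> B) \<le> \<phi> (arg_min_on \<phi> A) + C"
      if "A \<subseteq> carrier G" "finite A" "A \<noteq> {}" "B \<subseteq> carrier G" "finite B" "A \<subseteq> F <#> B" for A B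
    proof -
      have "arg_min_on \<phi> A \<in> F <#> B" using that arg_min_if_finite by blast
      then obtain u b where ub: "u \<in> F" "b \<in> B" "arg_min_on \<phi> A = u \<otimes> b" by (rule mem_set_multE)
      have "\<phi> (arg_min_on \<phi> B) \<le> \<phi> b" using arg_min_least[OF that(5) _ ub(2)] ub(2) by blast
      moreover have "\<bar>\<phi> (u \<otimes> b) - \<phi> b\<bar> \<le> C" using C ub that by blast
      ultimately show ?thesis using ub(3) by simp
    qed
    \<comment> \<open>Only exponents are compared, so it does not matter which of several minimisers
      is picked.\<close>
    have "arg_min_on \<phi> B \<in> K #> arg_min_on \<phi> A"
      if "A \<subseteq> carrier G" "finite A" "A \<noteq> {}" "B \<subseteq> carrier G" "finite B" "B \<noteq> {}"
        "A \<subseteq> F <#> B" "B \<subseteq> F <#> A" for A B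
    proof (rule near)
      show "arg_min_on \<phi> A \<in> carrier G" "arg_min_on \<phi> B \<in> carrier G"
        using that arg_min_if_finite by blast+
      show "\<bar>\<phi> (arg_min_on \<phi> B) - \<phi> (arg_min_on \<phi> A)\<bar> \<le> C" using le[of A B] le[of B A] that by simp
    qed
    then show "\<exists>K. finite K \<and> K \<subseteq> carrier G \<and>
      (\<forall>A B. A \<subseteq> carrier G \<longrightarrow> finite A \<longrightarrow> A \<noteq> {} \<longrightarrow> B \<subseteq> carrier G \<longrightarrow> finite B \<longrightarrow> B \<noteq> {} \<longrightarrow>
        A \<subseteq> F <#> B \<longrightarrow> B \<subseteq> F <#> A \<longrightarrow> arg_min_on \<phi> B \<in> K #> arg_min_on \<phi> A)"
      using K by blast
  qed (rule arg_min_if_finite)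
qed

text \<open>Initial segments of an enumeration generate an increasing chain of finite subgroups
  exhausting the group. A finite \<open>F\<close> is contained in some member of the chain, and that
  member is the bound for the selected points.\<close>

lemma locally_finite_selector:
  assumes cnt: "countable (carrier G)" and lf: "locally_finite_group G"
  shows "admits_finitary_selector G"
proof -
  define c where "c = to_nat_on (carrier G)"
  have c: "inj_on c (carrier G)" using cnt unfolding c_def by (rule inj_on_to_nat_on)
  define B where "B n = {x \<in> carrier G. c x < n}" for n
  define U where "U n = generate G (B n)" for n
  have B: "finite (B n)" "B n \<subseteq> carrier G" for n
  proof -
    have "c ` B n \<subseteq> {..<n}" "inj_on c (B n)" using c by (auto simp: B_def inj_on_def)
    then show "finite (B n)" using finite_lessThan finite_subset finite_imageD by metis
  qed (auto simp: B_def)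
  have U: "subgroup (U n) G" "finite (U n)" "U n \<subseteq> carrier G" for n
    using generate_is_subgroup[OF B(2)] lf B generate_incl[OF B(2)]
    by (auto simp: U_def locally_finite_group_def)
  have U_mono: "U m \<subseteq> U n" if "m \<le> n" for m n
    unfolding U_def by (rule mono_generate) (use that in \<open>auto simp: B_def\<close>)
  have U_ex: "\<exists>n. x \<in> U n" if "x \<in> carrier G" for x
    unfolding U_def using that by (intro exI[of _ "Suc (c x)"] generate.incl) (simp add: B_def)
  \<comment> \<open>An injective label of the coset of \<open>x\<close> at level \<open>n\<close>. As the label sequences of two elements
    eventually agree, they can be compared at the last place where they differ; this order makes
    every coset of every \<open>U n\<close> convex, so minima of close finite sets lie in the same coset.\<close>
  define k where "k n x = (LEAST i. i \<in> c ` (U n #> x))" for n x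
  have k_eq: "k n x = k n y \<longleftrightarrow> x \<in> U n #> y" if x: "x \<in> carrier G" and y: "y \<in> carrier G" for n x y
  proof
    assume "x \<in> U n #> y"
    then have "U n #> y = U n #> x" using repr_independence y U(1) by blast
    then show "k n x = k n y" by (simp add: k_def)
  next
    assume eq: "k n x = k n y"
    have "k n z \<in> c ` (U n #> z)" if "z \<in> carrier G" for z
      unfolding k_def by (rule LeastI[of _ "c z"]) (use rcos_self[OF that U(1)] in blast)
    then obtain v w where vw: "v \<in> U n #> x" "k n x = c v" "w \<in> U n #> y" "k n y = c w"
      using x y by (metis imageE)
    moreover have "v \<in> carrier G" "w \<in> carrier G"
      using vw r_coset_subset_G[OF U(3)] x y by blast+
    ultimately have "v \<in> U n #> x" "v \<in> U n #> y" using c eq by (auto simp: inj_on_def)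
    then have "U n #> x = U n #> y" using repr_independence x y U(1) by metis
    then show "x \<in> U n #> y" using rcos_self[OF x U(1), of n] by simp
  qed
  \<comment> \<open>Cosets grow with the level, so labels that agree once agree from then
    on.\<close>
  have k_mono: "k n x = k n y" if "x \<in> carrier G" "y \<in> carrier G" "k m x = k m y" "m \<le> n" for m n x y
    using that k_eq U_mono[OF that(4)] by (auto simp: r_coset_def)
  have k_ev: "\<exists>n. k n x = k n y" if x: "x \<in> carrier G" and y: "y \<in> carrier G" for x y
  proof -
    obtain n where "x \<otimes> inv y \<in> U n" using U_ex x y by (meson m_closed inv_closed)
    then show ?thesis using k_eq[OF x y] mem_r_coset_iff[OF U(3) x y] by blast
  qed
  define lt where "lt x y \<longleftrightarrow> (\<exists>n. k n x < k n y \<and> (\<forall>m>n. k m x = k m y))" for x y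
  have trans: "transp lt"
  proof (rule transpI)
    fix x y z assume "lt x y" "lt y z"
    then obtain m n where mn: "k m x < k m y" "\<forall>i>m. k i x = k i y" "k n y < k n z" "\<forall>i>n. k i y = k i z"
      by (auto simp: lt_def)
    show "lt x z" unfolding lt_def
      by (rule exI[of _ "max m n"]) (use mn in \<open>cases m n rule: linorder_cases; auto simp: max_def\<close>)
  qed
  have asym: "asymp lt"
  proof (rule asympI)
    fix x y assume "lt x y"
    then obtain m where m: "k m x < k m y" "\<forall>i>m. k i x = k i y" by (auto simp: lt_def)
    show "\<not> lt y x"
    proof
      assume "lt y x"
      then obtain n where "k n y < k n x" "\<forall>i>n. k i y = k i x" by (auto simp: lt_def)
      then show False using m by (cases m n rule: linorder_cases) auto
    qed
  qed
  define f where "f A = (SOME a. a \<in> A \<and> (\<forall>b\<in>A. b \<noteq> a \<longrightarrow> \<not> lt b a))" for A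
  have f: "f A \<in> A \<and> (\<forall>b\<in>A. b \<noteq> f A \<longrightarrow> \<not> lt b (f A))" if A: "finite A" "A \<noteq> {}" for A
  proof -
    have "\<exists>a\<in>A. \<forall>b\<in>A. b \<noteq> a \<longrightarrow> \<not> lt b a"
      using Finite_Set.bex_min_element[OF A(1) _ _ A(2), of lt] asym trans
      by (blast intro: asymp_on_subset transp_on_subset)
    then show ?thesis unfolding f_def by (intro someI_ex[of "\<lambda>a. a \<in> A \<and> _ a"]) blast
  qed
  show ?thesis
  proof (rule finitary_selectorI[of f])
    fix F assume F: "finite F" "F \<subseteq> carrier G"
    have "\<exists>n. F \<subseteq> U n"
      using F
    proof (induction F)
      case (insert x F)
      then obtain m where "F \<subseteq> U m" by auto
      moreover obtain n where "x \<in> U n" using U_ex[of x] insert.prems by auto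
      ultimately have "insert x F \<subseteq> U (max m n)" using U_mono[of m "max m n"] U_mono[of n "max m n"] by auto
      then show ?case by blast
    qed simp
    then obtain n where n: "F \<subseteq> U n" by blast
    \<comment> \<open>The point \<open>b\<close> of \<open>B\<close> one step away from
      \<open>a\<close> shares its labels from level \<open>n\<close> on. If \<open>a\<close> is
      below \<open>f B\<close> through a level \<open>i \<ge> n\<close>, then so is
      \<open>b\<close>, against the minimality of \<open>f B\<close>.\<close>
    have no_lt: False
      if A: "A \<subseteq> carrier G" "finite A" and B: "B \<subseteq> carrier G" "finite B" "B \<noteq> {}" and AB: "A \<subseteq> F <#> B"
        and a: "a \<in> A" and i: "n \<le> i" "k i a < k i (f B)" "\<forall>j>i. k j a = k j (f B)" for A B a i
    proof -
      have "a \<in> F <#> B" using a AB by blast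
      then obtain u b where b: "u \<in> F" "b \<in> B" "a = u \<otimes> b" by (rule mem_set_multE)
      then have G: "a \<in> carrier G" "b \<in> carrier G" using A B a by auto
      have "a \<in> U n #> b" using b n by (auto simp: r_coset_def)
      then have "k n a = k n b" using k_eq[OF G] by simp
      then have kb: "k j b = k j a" if "n \<le> j" for j using k_mono[OF G _ that] by simp
      then have "lt b (f B)" unfolding lt_def using i kb by (intro exI[of _ i]) auto
      moreover have "b \<noteq> f B" using kb[OF i(1)] i by auto
      ultimately show False using f[OF B(2,3)] b(2) by blast
    qed
    have "f B \<in> U n #> f A"
      if A: "A \<subseteq> carrier G" "finite A" "A \<noteq> {}" and B: "B \<subseteq> carrier G" "finite B" "B \<noteq> {}"
        and AB: "A \<subseteq> F <#> B" "B \<subseteq> F <#> A" for A B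
    proof (rule ccontr)
      assume far: "f B \<notin> U n #> f A"
      have m: "f A \<in> A" "f B \<in> B" using f A B by blast+
      then have G: "f A \<in> carrier G" "f B \<in> carrier G" using A B by blast+
      have ne: "k n (f A) \<noteq> k n (f B)" using far k_eq[OF G(2,1), of n] by simp
      obtain N where N: "k N (f A) = k N (f B)" using k_ev[OF G] by blast
      let ?I = "{i. k i (f A) \<noteq> k i (f B)}"
      have "?I \<subseteq> {..<N}" using k_mono[OF G N] by (auto intro: ccontr simp: not_less)
      then have fin: "finite ?I" using finite_subset by blast
      \<comment> \<open>The last level of disagreement; it is at least \<open>n\<close> because the
        selected points lie in different cosets of \<open>U n\<close>.\<close>
      define i where "i = Max ?I"
      have i: "k i (f A) \<noteq> k i (f B)" "n \<le> i" using Max_in[OF fin] Max_ge[OF fin] ne unfolding i_def by auto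
      have gt: "\<forall>j>i. k j (f A) = k j (f B)" using Max_ge[OF fin] unfolding i_def by (metis (mono_tags) leD mem_Collect_eq)
      then have "k i (f A) < k i (f B) \<or> k i (f B) < k i (f A)" using i by linarith
      then show False
        using no_lt[OF A(1,2) B AB(1) m(1) i(2)] no_lt[OF B(1,2) A AB(2) m(2) i(2)] gt by auto
    qed
    then show "\<exists>K. finite K \<and> K \<subseteq> carrier G \<and>
      (\<forall>A B. A \<subseteq> carrier G \<longrightarrow> finite A \<longrightarrow> A \<noteq> {} \<longrightarrow> B \<subseteq> carrier G \<longrightarrow> finite B \<longrightarrow> B \<noteq> {} \<longrightarrow>
        A \<subseteq> F <#> B \<longrightarrow> B \<subseteq> F <#> A \<longrightarrow> f B \<in> K #> f A)"
      by (intro exI[of _ "U n"] conjI allI impI U)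
  qed (use f in blast)
qed

end

theorem theorem1:
  fixes G (structure)
  assumes "group G"
  shows "(admits_finitary_selector G \<longleftrightarrow> admits_2_selector G) \<and>
         (admits_2_selector G \<longleftrightarrow>
            finite_extension_of_infinite_cyclic G \<or>
            (countable (carrier G) \<and> locally_finite_group G))"
proof -
  interpret group G by (rule assms)
  show ?thesis
    using finitary_imp_2_selector two_selector_structure infinite_cyclic_selector
      locally_finite_selector by blast
qed

end
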